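(* (1) Let $G=(V,E)$ be a finite graph with coupling constants $J\in(0,\infty)^E$, and write $p(J)_e=1-e^{-2J_e}$. Then for any $p\in(0,1]^E$ with $p\le p(J)$ pointwise, $\mathcal E_J$ has the $p$-weak FKG property, and for any coupling constants $J_2\ge J_1\ge J$ (pointwise), $\mathcal E_{J_1}\preccurlyeq_p\mathcal E_{J_2}$. (2) Let $n\in\mathbb N$, $J\in(0,\infty)^n$ and $p\in(0,1]^{n+1}$ (with coordinates such that $p_1,\dots,p_n$ correspond to $J_1,\dots,J_n$) be such that $$\sum_{k=1}^n\frac{p_k-(1-e^{-2J_k})}{p_k}>1.$$ Then there exist a finite graph $G$ with $n+1$ edges, numbered so that the coordinates of $p$ are indexed by the edges, and coupling constants $J_G$ on $G$ such that: - the restriction of $J_G$ to the first $n$ edges (those corresponding to $p_1,\dots,p_n$) equals $J$; - $\mathcal E_{J_G}$ does not satisfy the $p$-weak FKG property; - there is $J'_G\ge J_G$ (pointwise) such that $\mathcal E_{J_G}\preccurlyeq_p\mathcal E_{J'_G}$ does not hold.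
   Context: For a finite graph $G=(V,E)$ and coupling constants $J\in(0,\infty)^E$, the (free) Ising model is the probability measure on $\{\pm1\}^V$ with $\mathbb P_J(\sigma)\propto \exp\big(2\sum_{e\in E}J_e\xi(\sigma)_e\big)$, where $\xi(\sigma)\in\{0,1\}^E$, $\xi(\sigma)_{xy}=\mathbf 1_{\sigma(x)=\sigma(y)}$ for each edge $(xy)$. The Ising energy field $\mathcal E_J$ is the law of $\xi(\sigma)$ for $\sigma\sim\mathbb P_J$. Configurations in $\{0,1\}^E$ are identified with subsets of $E$. For a probability measure $\mu$ on $\{0,1\}^E$ and $p\in[0,1]^E$, $\mu_p=\mu\cap\mathrm{Ber}_p$ is the law of $\omega\cap\eta$ with $\omega\sim\mu$ and $\eta\sim\mathrm{Ber}_p$ (product Bernoulli with parameters $p_e$) independent. $\preccurlyeq$ is stochastic domination ($\mu(A)\le\nu(A)$ for all increasing events $A$). For $p\in(0,1]^E$: $\mu\preccurlyeq_p\nu$ ("$\nu$ $p$-weakly dominates $\mu$") means $\mu_p\preccurlyeq\nu_p$; $\mu$ satisfies the $p$-weak FKG property if $\mu_p(fg)\ge\mu_p(f)\mu_p(g)$ for all increasing functions $f,g:\{0,1\}^E\to\mathbb R$. *)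

theory Defs
  imports "HOL-Probability.Probability"
begin

definition finite_graph :: "'a set \<Rightarrow> 'a set set \<Rightarrow> bool" where
  "finite_graph V E \<longleftrightarrow> finite V \<and> (\<forall>e\<in>E. e \<subseteq> V \<and> card e = 2)"

definition spin_configs :: "'a set \<Rightarrow> ('a \<Rightarrow> int) set" where
  "spin_configs V = (V \<rightarrow>\<^sub>E {-1, 1})"

text \<open>Percolation configurations in \<open>{0,1}\<^sup>E\<close> are identified with subsets of \<open>E\<close> throughout:
  \<open>agreement E \<sigma>\<close> is the set of edges \<open>e\<close> with \<open>\<xi>(\<sigma>)\<^sub>e = 1\<close>.\<close>

definition agreement :: "'a set set \<Rightarrow> ('a \<Rightarrow> int) \<Rightarrow> 'a set set" where
  "agreement E \<sigma> = {e \<in> E. \<forall>x\<in>e. \<forall>y\<in>e. \<sigma> x = \<sigma> y}"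

definition ising_weight :: "'a set set \<Rightarrow> ('a set \<Rightarrow> real) \<Rightarrow> ('a \<Rightarrow> int) \<Rightarrow> real" where
  "ising_weight E J \<sigma> = exp (2 * (\<Sum>e\<in>E. J e * of_bool (e \<in> agreement E \<sigma>)))"

definition ising_partition :: "'a set \<Rightarrow> 'a set set \<Rightarrow> ('a set \<Rightarrow> real) \<Rightarrow> real" where
  "ising_partition V E J = (\<Sum>\<sigma>\<in>spin_configs V. ising_weight E J \<sigma>)"

definition ising :: "'a set \<Rightarrow> 'a set set \<Rightarrow> ('a set \<Rightarrow> real) \<Rightarrow> ('a \<Rightarrow> int) pmf" where
  "ising V E J = embed_pmf (\<lambda>\<sigma>. if \<sigma> \<in> spin_configs V
     then ising_weight E J \<sigma> / ising_partition V E J else 0)"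

lemma finite_spin_configs: "finite V \<Longrightarrow> finite (spin_configs V)"
  unfolding spin_configs_def by (intro finite_PiE) auto

lemma ising_partition_pos:
  assumes "finite V"
  shows "ising_partition V E J > 0"
proof -
  have "spin_configs V \<noteq> {}"
    unfolding spin_configs_def by (auto simp: PiE_eq_empty_iff)
  then show ?thesis
    unfolding ising_partition_def ising_weight_def
    by (intro sum_pos finite_spin_configs assms) auto
qed

text \<open>\<open>embed_pmf\<close> is only meaningful on a density of total mass 1; this is the case here.\<close>

lemma pmf_ising:
  assumes "finite V"
  shows "pmf (ising V E J) \<sigma> =
    (if \<sigma> \<in> spin_configs V then ising_weight E J \<sigma> / ising_partition V E J else 0)"
proof -
  let ?f = "\<lambda>\<sigma>. if \<sigma> \<in> spin_configs V then ising_weight E J \<sigma> / ising_partition V E J else 0"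
  have nonneg: "?f \<tau> \<ge> 0" for \<tau>
    using ising_partition_pos[OF assms, of E J] by (auto simp: ising_weight_def)
  have "(\<integral>\<^sup>+ \<tau>. ennreal (?f \<tau>) \<partial>count_space UNIV) = (\<Sum>\<tau>\<in>spin_configs V. ennreal (?f \<tau>))"
    by (intro nn_integral_count_space' finite_spin_configs assms) auto
  also have "\<dots> = ennreal (\<Sum>\<tau>\<in>spin_configs V. ?f \<tau>)"
    by (intro sum_ennreal nonneg)
  also have "(\<Sum>\<tau>\<in>spin_configs V. ?f \<tau>) = 1"
    using ising_partition_pos[OF assms, of E J]
    by (simp add: ising_partition_def flip: sum_divide_distrib)
  finally show ?thesis
    unfolding ising_def using nonneg by (subst pmf_embed_pmf) auto
qed

definition energy_field :: "'a set \<Rightarrow> 'a set set \<Rightarrow> ('a set \<Rightarrow> real) \<Rightarrow> 'a set set pmf" where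
  "energy_field V E J = map_pmf (agreement E) (ising V E J)"

definition bernoulli_percolation :: "'e set \<Rightarrow> ('e \<Rightarrow> real) \<Rightarrow> 'e set pmf" where
  "bernoulli_percolation E p =
     map_pmf (\<lambda>b. {e \<in> E. b e}) (Pi_pmf E False (\<lambda>e. bernoulli_pmf (p e)))"

definition thinning :: "'e set \<Rightarrow> ('e \<Rightarrow> real) \<Rightarrow> 'e set pmf \<Rightarrow> 'e set pmf" where
  "thinning E p \<mu> = map_pmf (\<lambda>(\<omega>, \<eta>). \<omega> \<inter> \<eta>) (pair_pmf \<mu> (bernoulli_percolation E p))"

definition increasing_event :: "'e set \<Rightarrow> 'e set set \<Rightarrow> bool" where
  "increasing_event E A \<longleftrightarrow> A \<subseteq> Pow E \<and> (\<forall>\<omega>\<in>A. \<forall>\<omega>'\<in>Pow E. \<omega> \<subseteq> \<omega>' \<longrightarrow> \<omega>' \<in> A)"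

definition stoch_dominated :: "'e set \<Rightarrow> 'e set pmf \<Rightarrow> 'e set pmf \<Rightarrow> bool" where
  "stoch_dominated E \<mu> \<nu> \<longleftrightarrow>
     (\<forall>A. increasing_event E A \<longrightarrow> measure_pmf.prob \<mu> A \<le> measure_pmf.prob \<nu> A)"

definition weakly_dominated :: "'e set \<Rightarrow> ('e \<Rightarrow> real) \<Rightarrow> 'e set pmf \<Rightarrow> 'e set pmf \<Rightarrow> bool" where
  "weakly_dominated E p \<mu> \<nu> \<longleftrightarrow> stoch_dominated E (thinning E p \<mu>) (thinning E p \<nu>)"

definition weak_FKG :: "'e set \<Rightarrow> ('e \<Rightarrow> real) \<Rightarrow> 'e set pmf \<Rightarrow> bool" where
  "weak_FKG E p \<mu> \<longleftrightarrow>
     (\<forall>f g :: 'e set \<Rightarrow> real. mono_on (Pow E) f \<longrightarrow> mono_on (Pow E) g \<longrightarrow>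
        measure_pmf.expectation (thinning E p \<mu>) (\<lambda>\<omega>. f \<omega> * g \<omega>) \<ge>
        measure_pmf.expectation (thinning E p \<mu>) f * measure_pmf.expectation (thinning E p \<mu>) g)"

end

theory Submission
  imports Defs
begin

text \<open>For part (1), write \<open>a = e\<^bsup>2J\<^esup>\<close>. An edge on which the spins agree carries weight \<open>a p\<close> when it
  survives the thinning and \<open>a (1 - p) = 1 + b\<close> when it does not, and \<open>p \<le> p(J)\<close> says exactly that
  \<open>b \<ge> 0\<close>. Expanding the factors \<open>1 + b\<close> as in the random-cluster representation couples the thinned
  set \<open>\<omega>\<close> with a larger set \<open>\<theta>\<close>, with weight \<open>(a p)\<^bsup>\<omega>\<^esup> b\<^bsup>\<theta> - \<omega>\<^esup> N(\<theta>)\<close>, where \<open>N(\<theta>)\<close> counts the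
  spin configurations that are constant on the edges of \<open>\<theta>\<close>. These form a subgroup \<open>U(\<theta>)\<close> of
  \<open>{-1, 1}\<^bsup>V\<^esup>\<close>, and \<open>U(\<theta>) \<inter> U(\<theta>') = U(\<theta> \<union> \<theta>')\<close>, \<open>U(\<theta>) U(\<theta>') \<subseteq> U(\<theta> \<inter> \<theta>')\<close>, so \<open>N\<close> is
  log-supermodular. Summing out \<open>\<theta>\<close> by the four functions theorem gives the lattice condition for
  \<open>\<omega>\<close>, hence FKG. Raising \<open>J\<close> to \<open>J'\<close> replaces \<open>N(\<theta>)\<close> by a sum, with nonnegative coefficients, of
  \<open>N(\<theta> \<union> T)\<close> over \<open>T\<close>, which gives Holley's condition in the same way.

  For part (2), take a cycle with \<open>n + 1\<close> edges and the increasing event \<open>A\<close> that at most one of the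
  first \<open>n\<close> edges is closed. Up to normalisation the thinned field on a cycle is a product measure plus
  a signed product measure, of total masses \<open>R (a\<^sub>0 + 1)\<close> and \<open>T (a\<^sub>0 - 1)\<close> with \<open>a\<^sub>0\<close> belonging to the
  last edge; they give \<open>A\<close> the masses \<open>U (a\<^sub>0 + 1)\<close> and \<open>V (a\<^sub>0 - 1)\<close>. The hypothesis on \<open>p\<close> means
  \<open>V < 0\<close>, hence \<open>V R < U T\<close>. This makes the correlation of \<open>A\<close> with the last edge negative, and the
  probability of \<open>A\<close> strictly decreasing in the last coupling constant.\<close>

subsection \<open>The four functions theorem and its consequences\<close>

lemma sum_Pow_insert:
  fixes f :: "'b set \<Rightarrow> real"
  assumes "finite S" "x \<notin> S"
  shows "(\<Sum>A\<in>Pow (insert x S). f A) = (\<Sum>A\<in>Pow S. f A + f (insert x A))"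
proof -
  have "inj_on (insert x) (Pow S)" "Pow S \<inter> insert x ` Pow S = {}"
    using assms by (auto simp: inj_on_def)
  then show ?thesis
    using assms by (simp add: Pow_insert sum.union_disjoint sum.reindex sum.distrib)
qed

text \<open>The one-point case of the four functions theorem. Both mixed products \<open>v\<close>
  and \<open>w\<close> are bounded by the same \<open>u\<close>, so adding the hypotheses does not
  suffice. The gain comes from \<open>(u - v) * (u - w) \<ge> 0\<close> and
  \<open>v * w \<le> u * (c False * d True)\<close>, after division by \<open>u\<close>.\<close>

lemma four_numbers:
  fixes a b c d :: "bool \<Rightarrow> real"
  assumes nonneg: "\<And>i. a i \<ge> 0" "\<And>i. b i \<ge> 0" "\<And>i. c i \<ge> 0" "\<And>i. d i \<ge> 0"
    and le: "\<And>i j. a i * b j \<le> c (i \<or> j) * d (i \<and> j)"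
  shows "(a False + a True) * (b False + b True) \<le> (c False + c True) * (d False + d True)"
proof -
  have le_FF: "a False * b False \<le> c False * d False"
    and le_FT: "a False * b True \<le> c True * d False"
    and le_TF: "a True * b False \<le> c True * d False"
    and le_TT: "a True * b True \<le> c True * d True"
    using le[of False False] le[of False True] le[of True False] le[of True True] by auto
  show ?thesis
  proof (cases "c True * d False = 0")
    case True
    then have "a False * b True = 0" "a True * b False = 0"
      using le_FT le_TF nonneg by (metis mult_nonneg_nonneg order_antisym)+
    moreover have "0 \<le> c False * d True" "0 \<le> c True * d False"
      by (simp_all add: nonneg)
    ultimately show ?thesis
      using le_FF le_TT unfolding distrib_left distrib_right by linarith
  next
    case False
    define u v w where "u = c True * d False" and "v = a False * b True" and "w = a True * b False"
    have "u > 0"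
      using False nonneg unfolding u_def by (simp add: order_less_le)
    have "v * w = (a False * b False) * (a True * b True)"
      by (simp add: v_def w_def)
    also have "\<dots> \<le> (c False * d False) * (c True * d True)"
      by (intro mult_mono le_FF le_TT) (simp_all add: nonneg)
    also have "\<dots> = u * (c False * d True)"
      by (simp add: u_def)
    finally have "v * w \<le> u * (c False * d True)" .
    moreover have "(u - v) * (u - w) \<ge> 0"
      using le_FT le_TF by (simp add: u_def v_def w_def)
    ultimately have "u * (v + w) \<le> u * (u + c False * d True)"
      by (simp add: algebra_simps)
    then have "v + w \<le> u + c False * d True"
      using \<open>u > 0\<close> by simp
    then show ?thesis
      using le_FF le_TT by (simp add: u_def v_def w_def algebra_simps)
  qed
qed

text \<open>The Ahlswede-Daykin inequality, by induction on \<open>S\<close>: summing over whether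
  \<open>x\<close> belongs to the set leaves four functions on \<open>Pow S\<close>, which inherit
  the hypothesis by \<open>four_numbers\<close>.\<close>

theorem four_functions:
  fixes \<alpha> \<beta> \<gamma> \<delta> :: "'b set \<Rightarrow> real"
  assumes "finite S"
    and "\<And>A. A \<subseteq> S \<Longrightarrow> \<alpha> A \<ge> 0" "\<And>A. A \<subseteq> S \<Longrightarrow> \<beta> A \<ge> 0"
    and "\<And>A. A \<subseteq> S \<Longrightarrow> \<gamma> A \<ge> 0" "\<And>A. A \<subseteq> S \<Longrightarrow> \<delta> A \<ge> 0"
    and "\<And>A B. A \<subseteq> S \<Longrightarrow> B \<subseteq> S \<Longrightarrow> \<alpha> A * \<beta> B \<le> \<gamma> (A \<union> B) * \<delta> (A \<inter> B)"
  shows "sum \<alpha> (Pow S) * sum \<beta> (Pow S) \<le> sum \<gamma> (Pow S) * sum \<delta> (Pow S)"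
  using assms
proof (induction S arbitrary: \<alpha> \<beta> \<gamma> \<delta> rule: finite_induct)
  case empty
  from empty(5)[of "{}" "{}"] show ?case by simp
next
  case (insert x S)
  let ?m = "\<lambda>f A. f A + f (insert x A) :: real"
  have "sum (?m \<alpha>) (Pow S) * sum (?m \<beta>) (Pow S) \<le> sum (?m \<gamma>) (Pow S) * sum (?m \<delta>) (Pow S)"
  proof (rule insert.IH)
    fix A B assume AB: "A \<subseteq> S" "B \<subseteq> S"
    \<comment> \<open>The flag records membership of \<open>x\<close>. Since \<open>x\<close> is in
      neither \<open>A\<close> nor \<open>B\<close>, unions and intersections act on flags as
      disjunction and conjunction.\<close>
    define ext where "ext i C = (if i then insert x C else C)" for i C
    have x: "x \<notin> A" "x \<notin> B"
      using AB insert.hyps by auto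
    have sub: "ext i C \<subseteq> insert x S" if "C \<subseteq> S" for i C
      using that by (auto simp: ext_def)
    have union: "ext i A \<union> ext j B = ext (i \<or> j) (A \<union> B)" for i j
      by (auto simp: ext_def)
    have inter: "ext i A \<inter> ext j B = ext (i \<and> j) (A \<inter> B)" for i j
      using x by (auto simp: ext_def)
    have "(\<alpha> (ext False A) + \<alpha> (ext True A)) * (\<beta> (ext False B) + \<beta> (ext True B))
        \<le> (\<gamma> (ext False (A \<union> B)) + \<gamma> (ext True (A \<union> B))) *
          (\<delta> (ext False (A \<inter> B)) + \<delta> (ext True (A \<inter> B)))"
    proof (rule four_numbers)
      fix i j
      show "\<alpha> (ext i A) * \<beta> (ext j B) \<le> \<gamma> (ext (i \<or> j) (A \<union> B)) * \<delta> (ext (i \<and> j) (A \<inter> B))"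
        using insert.prems(5)[OF sub[OF AB(1)] sub[OF AB(2)], of i j] by (simp add: union inter)
    qed (use AB in \<open>auto intro!: insert.prems sub\<close>)
    then show "?m \<alpha> A * ?m \<beta> B \<le> ?m \<gamma> (A \<union> B) * ?m \<delta> (A \<inter> B)"
      by (simp add: ext_def)
  qed (intro add_nonneg_nonneg insert.prems(1-4); blast)+
  then show ?case
    using insert.hyps by (simp add: sum_Pow_insert)
qed

text \<open>Contains Holley's inequality (\<open>f = 1\<close>) and the FKG inequality
  (\<open>\<mu> = \<nu>\<close>). Monotonicity moves both \<open>f\<close> and \<open>g\<close> to
  the union, the argument of the third function in the four functions theorem.\<close>

lemma holley_FKG:
  fixes \<mu> \<nu> f g :: "'b set \<Rightarrow> real"
  assumes "finite S"
    and "\<And>A. A \<subseteq> S \<Longrightarrow> \<mu> A \<ge> 0" "\<And>A. A \<subseteq> S \<Longrightarrow> \<nu> A \<ge> 0"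
    and le: "\<And>A B. A \<subseteq> S \<Longrightarrow> B \<subseteq> S \<Longrightarrow> \<nu> A * \<mu> B \<le> \<nu> (A \<union> B) * \<mu> (A \<inter> B)"
    and f: "mono_on (Pow S) f" "\<And>A. A \<subseteq> S \<Longrightarrow> f A \<ge> 0"
    and g: "mono_on (Pow S) g" "\<And>A. A \<subseteq> S \<Longrightarrow> g A \<ge> 0"
  shows "(\<Sum>A\<in>Pow S. f A * \<nu> A) * (\<Sum>A\<in>Pow S. g A * \<mu> A)
    \<le> (\<Sum>A\<in>Pow S. f A * g A * \<nu> A) * (\<Sum>A\<in>Pow S. \<mu> A)"
proof (rule four_functions)
  fix A B assume AB: "A \<subseteq> S" "B \<subseteq> S"
  have fg: "f A * g B \<le> f (A \<union> B) * g (A \<union> B)"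
    using AB by (intro mult_mono mono_onD[OF f(1)] mono_onD[OF g(1)] f(2) g(2)) auto
  have "(f A * g B) * (\<nu> A * \<mu> B)
      \<le> (f (A \<union> B) * g (A \<union> B)) * (\<nu> (A \<union> B) * \<mu> (A \<inter> B))"
    using AB by (intro mult_mono[OF fg le[OF AB]] mult_nonneg_nonneg assms(2,3) f(2) g(2)) auto
  then show "f A * \<nu> A * (g B * \<mu> B)
      \<le> f (A \<union> B) * g (A \<union> B) * \<nu> (A \<union> B) * \<mu> (A \<inter> B)"
    by (simp add: mult_ac)
qed (auto intro!: mult_nonneg_nonneg assms(1-3) f(2) g(2))

lemma FKG_inequality:
  fixes \<mu> f g :: "'b set \<Rightarrow> real"
  assumes "finite S"
    and "\<And>A. A \<subseteq> S \<Longrightarrow> \<mu> A \<ge> 0"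
    and "\<And>A B. A \<subseteq> S \<Longrightarrow> B \<subseteq> S \<Longrightarrow> \<mu> A * \<mu> B \<le> \<mu> (A \<union> B) * \<mu> (A \<inter> B)"
    and f: "mono_on (Pow S) f" and g: "mono_on (Pow S) g"
  shows "(\<Sum>A\<in>Pow S. f A * \<mu> A) * (\<Sum>A\<in>Pow S. g A * \<mu> A)
    \<le> (\<Sum>A\<in>Pow S. f A * g A * \<mu> A) * (\<Sum>A\<in>Pow S. \<mu> A)"
proof -
  \<comment> \<open>Subtracting the minima over \<open>Pow S\<close> makes both functions
    nonnegative and, as for any covariance, leaves the difference of the two sides
    unchanged.\<close>
  define f' g' where "f' A = f A - f {}" and "g' A = g A - g {}" for A
  have "(\<Sum>A\<in>Pow S. f' A * \<mu> A) * (\<Sum>A\<in>Pow S. g' A * \<mu> A)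
    \<le> (\<Sum>A\<in>Pow S. f' A * g' A * \<mu> A) * (\<Sum>A\<in>Pow S. \<mu> A)"
    using assms(1-3) f g
    by (intro holley_FKG) (auto simp: f'_def g'_def mono_on_def)
  moreover have "(\<Sum>A\<in>Pow S. f' A * \<mu> A) = (\<Sum>A\<in>Pow S. f A * \<mu> A) - f {} * (\<Sum>A\<in>Pow S. \<mu> A)"
    by (simp add: f'_def sum_distrib_left left_diff_distrib flip: sum_subtractf)
  moreover have "(\<Sum>A\<in>Pow S. g' A * \<mu> A) = (\<Sum>A\<in>Pow S. g A * \<mu> A) - g {} * (\<Sum>A\<in>Pow S. \<mu> A)"
    by (simp add: g'_def sum_distrib_left left_diff_distrib flip: sum_subtractf)
  moreover have "(\<Sum>A\<in>Pow S. f' A * g' A * \<mu> A) = (\<Sum>A\<in>Pow S. f A * g A * \<mu> A)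
      - f {} * (\<Sum>A\<in>Pow S. g A * \<mu> A) - g {} * (\<Sum>A\<in>Pow S. f A * \<mu> A)
      + f {} * g {} * (\<Sum>A\<in>Pow S. \<mu> A)"
    unfolding f'_def g'_def sum_distrib_left sum_subtractf[symmetric] sum.distrib[symmetric]
    by (intro sum.cong refl) (simp add: algebra_simps)
  ultimately show ?thesis
    by (simp only:) (simp add: algebra_simps)
qed

section \<open>Products over edges as sums over sets of edges\<close>

lemma prod_add_eq_sum_Pow:
  fixes h :: "'b \<Rightarrow> bool \<Rightarrow> real"
  assumes "finite S"
  shows "(\<Prod>e\<in>S. h e True + h e False) = (\<Sum>A\<in>Pow S. \<Prod>e\<in>S. h e (e \<in> A))"
proof -
  have "(\<Prod>e\<in>A. h e True) * (\<Prod>e\<in>S - A. h e False) = (\<Prod>e\<in>S. h e (e \<in> A))"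
    if "A \<subseteq> S" for A
  proof -
    have "(\<Prod>e\<in>S. h e (e \<in> A)) = (\<Prod>e\<in>S - A. h e (e \<in> A)) * (\<Prod>e\<in>A. h e (e \<in> A))"
      using assms that by (rule prod.subset_diff[rotated])
    then show ?thesis
      by (simp add: mult.commute)
  qed
  then show ?thesis
    using assms by (simp add: prod_add)
qed

lemma prod_if_eq_sum_Pow:
  fixes h :: "'b \<Rightarrow> bool \<Rightarrow> real"
  assumes "finite S" 
  shows "(\<Prod>e\<in>S. if e \<in> B then h e True + h e False else h e False)
    = (\<Sum>A\<in>Pow S. of_bool (A \<subseteq> B) * (\<Prod>e\<in>S. h e (e \<in> A)))"
proof -
  \<comment> \<open>With the \<open>True\<close> term set to zero outside \<open>B\<close>, only
    subsets of \<open>B\<close> survive in the full expansion.\<close>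
  define h' where "h' e t = (if t \<and> e \<notin> B then 0 else h e t)" for e t
  have "(\<Prod>e\<in>S. if e \<in> B then h e True + h e False else h e False)
      = (\<Prod>e\<in>S. h' e True + h' e False)"
    by (intro prod.cong) (auto simp: h'_def)
  also have "\<dots> = (\<Sum>A\<in>Pow S. \<Prod>e\<in>S. h' e (e \<in> A))"
    by (rule prod_add_eq_sum_Pow[OF assms])
  also have "\<dots> = (\<Sum>A\<in>Pow S. of_bool (A \<subseteq> B) * (\<Prod>e\<in>S. h e (e \<in> A)))"
  proof (intro sum.cong refl)
    fix A assume "A \<in> Pow S"
    then show "(\<Prod>e\<in>S. h' e (e \<in> A)) = of_bool (A \<subseteq> B) * (\<Prod>e\<in>S. h e (e \<in> A))"
      using assms by (cases "A \<subseteq> B") (auto simp: h'_def intro!: prod.cong)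
  qed
  finally show ?thesis .
qed

subsection \<open>Spin configurations that agree on a set of edges\<close>

text \<open>On a finite graph with \<open>\<theta> \<subseteq> E\<close> this is 2 to the number of
  connected components of \<open>(V, \<theta>)\<close>, the cluster weight of the random-cluster
  model with q = 2. Counting spins exhibits it as the order of a group.\<close>

definition num_agreeing :: "'a set \<Rightarrow> 'a set set \<Rightarrow> 'a set set \<Rightarrow> real" where
  "num_agreeing V E \<theta> = real (card {\<sigma> \<in> spin_configs V. \<theta> \<subseteq> agreement E \<sigma>})"

lemma num_agreeing_antimono:
  assumes "finite V" "\<theta> \<subseteq> \<theta>'"
  shows "num_agreeing V E \<theta>' \<le> num_agreeing V E \<theta>"
  unfolding num_agreeing_def using assms finite_spin_configs[OF assms(1)]
  by (intro of_nat_mono card_mono) auto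

text \<open>Closure of the subgroup under multiplication. The product is restricted to
  \<open>V\<close> to stay extensional, so the argument uses that edges lie inside
  \<open>V\<close>.\<close>

lemma agreementI_mult:
  assumes "\<theta> \<subseteq> agreement E \<sigma>" "\<theta> \<subseteq> agreement E \<tau>" "\<And>e. e \<in> E \<Longrightarrow> e \<subseteq> V"
  shows "\<theta> \<subseteq> agreement E (\<lambda>x\<in>V. \<sigma> x * \<tau> x)"
proof
  fix e assume "e \<in> \<theta>"
  then have "e \<in> agreement E \<sigma>" "e \<in> agreement E \<tau>"
    using assms(1,2) by blast+
  then have "\<sigma> x = \<sigma> y" "\<tau> x = \<tau> y" "x \<in> V" "y \<in> V" if "x \<in> e" "y \<in> e" for x y
    using that assms(3) unfolding agreement_def by blast+
  then have "(\<lambda>x\<in>V. \<sigma> x * \<tau> x) x = (\<lambda>x\<in>V. \<sigma> x * \<tau> x) y" if "x \<in> e" "y \<in> e" for x y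
    using that by (metis restrict_apply')
  then show "e \<in> agreement E (\<lambda>x\<in>V. \<sigma> x * \<tau> x)"
    using \<open>e \<in> agreement E \<sigma>\<close> unfolding agreement_def by blast
qed

text \<open>The product map \<open>U(\<theta>) \<times> U(\<theta>') \<rightarrow> U(\<theta> \<inter> \<theta>')\<close> has fibres of size at most \<open>|U(\<theta> \<union> \<theta>')|\<close>: choosing a
  representative in each fibre turns it into the injection \<open>F\<close> below.\<close>

lemma num_agreeing_supermodular:
  assumes "finite V" "\<And>e. e \<in> E \<Longrightarrow> e \<subseteq> V"
  shows "num_agreeing V E \<theta> * num_agreeing V E \<theta>'
    \<le> num_agreeing V E (\<theta> \<union> \<theta>') * num_agreeing V E (\<theta> \<inter> \<theta>')"
proof -
  define U where "U \<theta> = {\<sigma> \<in> spin_configs V. \<theta> \<subseteq> agreement E \<sigma>}" for \<theta>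
  define mul where "mul \<sigma> \<tau> = (\<lambda>x\<in>V. \<sigma> x * \<tau> x)" for \<sigma> \<tau> :: "'a \<Rightarrow> int"
  define m where "m = (\<lambda>(\<sigma>, \<tau>). mul \<sigma> \<tau>)"
  define P where "P = U \<theta> \<times> U \<theta>'"
  define r where "r = inv_into P m"
  define F where "F = (\<lambda>z. (mul (fst z) (fst (r (m z))), m z))"
  have fin: "finite (U \<theta>)" for \<theta>
    unfolding U_def using finite_spin_configs[OF assms(1)] by simp
  have mul_spin: "mul \<sigma> \<tau> \<in> spin_configs V" if "\<sigma> \<in> spin_configs V" "\<tau> \<in> spin_configs V" for \<sigma> \<tau>
    unfolding spin_configs_def mul_def
  proof (rule restrict_PiE_iff[THEN iffD2], rule ballI)
    fix x assume "x \<in> V"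
    then have "\<sigma> x \<in> {-1, 1}" "\<tau> x \<in> {-1, 1}"
      using that by (simp_all add: spin_configs_def PiE_iff)
    then show "\<sigma> x * \<tau> x \<in> {-1, 1}"
      by auto
  qed
  have mul_U: "mul \<sigma> \<tau> \<in> U \<theta>" if "\<sigma> \<in> U \<theta>" "\<tau> \<in> U \<theta>" for \<sigma> \<tau> \<theta>
    using that mul_spin[of \<sigma> \<tau>] agreementI_mult[of \<theta> E \<sigma> \<tau> V, OF _ _ assms(2)]
    by (simp add: U_def flip: mul_def)
  have cancel: "mul \<sigma> (mul \<sigma> \<tau>) = \<tau>"
    if "\<sigma> \<in> spin_configs V" "\<tau> \<in> spin_configs V" for \<sigma> \<tau>
  proof
    fix x
    show "mul \<sigma> (mul \<sigma> \<tau>) x = \<tau> x"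
      using that PiE_mem[of \<sigma> V "\<lambda>_. {-1, 1}" x] PiE_arb[of \<tau> V "\<lambda>_. {-1, 1}" x]
      by (cases "x \<in> V") (auto simp: spin_configs_def mul_def)
  qed
  have comm: "mul \<sigma> \<tau> = mul \<tau> \<sigma>" for \<sigma> \<tau>
    by (auto simp: mul_def mult.commute)
  have assoc: "mul (mul \<sigma> \<tau>) \<rho> = mul \<sigma> (mul \<tau> \<rho>)" for \<sigma> \<tau> \<rho>
    by (auto simp: mul_def)
  have U_spin: "\<sigma> \<in> spin_configs V" if "\<sigma> \<in> U \<theta>" for \<sigma> \<theta>
    using that by (simp add: U_def)
  have r: "r (m z) \<in> P" "m (r (m z)) = m z" if "z \<in> P" for z
    using that unfolding r_def by (blast intro: inv_into_into f_inv_into_f)+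
  have F_mem: "F z \<in> U (\<theta> \<union> \<theta>') \<times> U (\<theta> \<inter> \<theta>')" if "z \<in> P" for z
  proof -
    obtain \<sigma> \<tau> where z: "z = (\<sigma>, \<tau>)" "\<sigma> \<in> U \<theta>" "\<tau> \<in> U \<theta>'"
      using \<open>z \<in> P\<close> by (auto simp: P_def)
    obtain \<sigma>' \<tau>' where rz: "r (m z) = (\<sigma>', \<tau>')" "\<sigma>' \<in> U \<theta>" "\<tau>' \<in> U \<theta>'"
      using r(1)[OF \<open>z \<in> P\<close>] by (auto simp: P_def)
    have eq: "mul \<sigma>' \<tau>' = mul \<sigma> \<tau>"
      using r(2)[OF \<open>z \<in> P\<close>] z(1) rz(1) by (simp add: m_def)
    \<comment> \<open>Every spin configuration is its own inverse, so equal products in a fibre give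
      a common quotient: the first coordinates differ by the same element as the second ones, and it
      lies in both subgroups.\<close>
    have "mul \<sigma> \<sigma>' = mul \<sigma> (mul \<tau>' (mul \<sigma>' \<tau>'))"
      by (simp only: comm[of \<sigma>' \<tau>'] cancel[OF U_spin[OF rz(3)] U_spin[OF rz(2)]])
    also have "\<dots> = mul \<tau>' (mul \<sigma> (mul \<sigma> \<tau>))"
      by (simp only: eq assoc[symmetric] comm[of \<sigma> \<tau>'])
    also have "\<dots> = mul \<tau>' \<tau>"
      by (simp only: cancel[OF U_spin[OF z(2)] U_spin[OF z(3)]])
    finally have "mul \<sigma> \<sigma>' = mul \<tau>' \<tau>" .
    then have "mul \<sigma> \<sigma>' \<in> U \<theta> \<inter> U \<theta>'"
      using mul_U[OF z(2) rz(2)] mul_U[OF rz(3) z(3)] by simp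
    then have "mul \<sigma> \<sigma>' \<in> U (\<theta> \<union> \<theta>')"
      by (auto simp: U_def)
    moreover have "\<sigma> \<in> U (\<theta> \<inter> \<theta>')" "\<tau> \<in> U (\<theta> \<inter> \<theta>')"
      using z by (auto simp: U_def)
    then have "m z \<in> U (\<theta> \<inter> \<theta>')"
      using mul_U by (simp add: z(1) m_def)
    moreover have "F z = (mul \<sigma> \<sigma>', m z)"
      unfolding F_def rz(1) by (simp add: z(1))
    ultimately show ?thesis
      by simp
  qed
  have "inj_on F P"
  proof (rule inj_onI)
    fix z w assume "z \<in> P" "w \<in> P" "F z = F w"
    \<comment> \<open>Equal products select the same representative, whose first coordinate cancels;
      the second coordinates then agree by cancelling in \<open>m z = m w\<close>.\<close>
    then have "m z = m w" and "mul (fst z) (fst (r (m z))) = mul (fst w) (fst (r (m z)))"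
      by (auto simp: F_def)
    moreover have spin: "fst z \<in> spin_configs V" "snd z \<in> spin_configs V" "fst w \<in> spin_configs V"
      "snd w \<in> spin_configs V" "fst (r (m z)) \<in> spin_configs V"
      using \<open>z \<in> P\<close> \<open>w \<in> P\<close> r(1)[of z] by (auto simp: P_def U_def)
    ultimately have fst: "fst z = fst w"
      using cancel comm by metis
    have "mul (fst z) (snd z) = mul (fst z) (snd w)"
      using \<open>m z = m w\<close> fst by (simp add: m_def case_prod_beta)
    then have "snd z = snd w"
      using cancel spin(1,2,4) by metis
    then show "z = w"
      using fst by (simp add: prod_eq_iff)
  qed
  then have "card P \<le> card (U (\<theta> \<union> \<theta>') \<times> U (\<theta> \<inter> \<theta>'))"
    using F_mem fin by (intro card_inj_on_le[of F] image_subsetI finite_cartesian_product)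
  then show ?thesis
    unfolding num_agreeing_def U_def[symmetric] P_def
    by (simp add: card_cartesian_product flip: of_nat_mult)
qed

subsection \<open>The thinned energy field\<close>

lemma finite_graph_finite_edges: "finite_graph V E \<Longrightarrow> finite E"
  unfolding finite_graph_def by (auto intro: finite_subset[of E "Pow V"])

lemma pmf_bernoulli_percolation:
  assumes "finite E" "\<And>e. e \<in> E \<Longrightarrow> 0 \<le> p e \<and> p e \<le> 1" "\<omega> \<subseteq> E"
  shows "pmf (bernoulli_percolation E p) \<omega> = (\<Prod>e\<in>E. if e \<in> \<omega> then p e else 1 - p e)"
proof -
  let ?B = "Pi_pmf E False (\<lambda>e. bernoulli_pmf (p e))"
  \<comment> \<open>On the support, \<open>b\<close> is \<open>False\<close> outside
    \<open>E\<close>, so the comprehension is plain \<open>Collect\<close>, which is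
    injective.\<close>
  have "bernoulli_percolation E p = map_pmf Collect ?B"
    unfolding bernoulli_percolation_def
    by (intro map_pmf_cong refl) (use set_Pi_pmf_subset[OF assms(1)] in fastforce)
  then have "pmf (bernoulli_percolation E p) (Collect (\<lambda>e. e \<in> \<omega>)) = pmf ?B (\<lambda>e. e \<in> \<omega>)"
    by (simp only:) (rule pmf_map_inj', rule injI, erule Collect_inj)
  also have "\<dots> = (\<Prod>e\<in>E. pmf (bernoulli_pmf (p e)) (e \<in> \<omega>))"
    using assms by (intro pmf_Pi') auto
  also have "\<dots> = (\<Prod>e\<in>E. if e \<in> \<omega> then p e else 1 - p e)"
    using assms(2) by (intro prod.cong) auto
  finally show ?thesis
    by simp
qed

lemma set_bernoulli_percolation: "set_pmf (bernoulli_percolation E p) \<subseteq> Pow E"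
  unfolding bernoulli_percolation_def by auto

lemma bernoulli_percolation_inter:
  assumes "finite E" "\<xi> \<subseteq> E"
  shows "map_pmf ((\<inter>) \<xi>) (bernoulli_percolation E p) = bernoulli_percolation \<xi> p"
  unfolding bernoulli_percolation_def Pi_pmf_subset[OF assms] map_pmf_comp
  by (intro map_pmf_cong refl) (use assms(2) in auto)

text \<open>Joint weight of one edge: \<open>t\<close> says that its spins agree, \<open>s\<close>
  that it survives the thinning, and \<open>a\<close> stands for the exponential of twice the
  coupling.\<close>

definition thin_factor :: "real \<Rightarrow> real \<Rightarrow> bool \<Rightarrow> bool \<Rightarrow> real" where
  "thin_factor p a s t = (if t then a * (if s then p else 1 - p) else of_bool (\<not> s))"

definition thin_weight :: "'a set \<Rightarrow> 'a set set \<Rightarrow> ('a set \<Rightarrow> real) \<Rightarrow> ('a set \<Rightarrow> real) \<Rightarrow> 'a set set \<Rightarrow> real" where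
  "thin_weight V E J p \<omega> = (\<Sum>\<sigma>\<in>spin_configs V. \<Prod>e\<in>E.
     thin_factor (p e) (exp (2 * J e)) (e \<in> \<omega>) (e \<in> agreement E \<sigma>))"

lemma agreement_subset: "agreement E \<sigma> \<subseteq> E"
  by (auto simp: agreement_def)

lemma ising_weight_eq_prod:
  assumes "finite E"
  shows "ising_weight E J \<sigma> = (\<Prod>e\<in>E. if e \<in> agreement E \<sigma> then exp (2 * J e) else 1)"
  using assms unfolding ising_weight_def sum_distrib_left
  by (subst exp_sum) (auto intro!: prod.cong)

text \<open>Given the spins, the thinned set is Bernoulli percolation on the agreement set. If
  \<omega> leaves that set, both sides vanish, the right one through an edge of \<omega> with
  disagreeing spins.\<close>

lemma ising_weight_times_pmf:
  assumes "finite E" "\<And>e. e \<in> E \<Longrightarrow> 0 \<le> p e \<and> p e \<le> 1" "\<omega> \<subseteq> E"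
  shows "ising_weight E J \<sigma> * pmf (bernoulli_percolation (agreement E \<sigma>) p) \<omega> =
    (\<Prod>e\<in>E. thin_factor (p e) (exp (2 * J e)) (e \<in> \<omega>) (e \<in> agreement E \<sigma>))"
proof (cases "\<omega> \<subseteq> agreement E \<sigma>")
  case True
  have fin: "finite (agreement E \<sigma>)"
    using agreement_subset assms(1) by (rule finite_subset)
  have "pmf (bernoulli_percolation (agreement E \<sigma>) p) \<omega> =
      (\<Prod>e\<in>agreement E \<sigma>. if e \<in> \<omega> then p e else 1 - p e)"
    using assms(2) agreement_subset[of E \<sigma>] fin True
    by (intro pmf_bernoulli_percolation) auto
  also have "\<dots> = (\<Prod>e\<in>E. if e \<in> agreement E \<sigma> then if e \<in> \<omega> then p e else 1 - p e else 1)"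
    using agreement_subset[of E \<sigma>] assms(1) by (simp add: Int_absorb1 flip: prod.inter_restrict)
  finally show ?thesis
    unfolding ising_weight_eq_prod[OF assms(1)]
    using True by (auto simp: thin_factor_def simp flip: prod.distrib intro!: prod.cong)
next
  case False
  then obtain e where "e \<in> \<omega>" "e \<notin> agreement E \<sigma>"
    by auto
  then have "(\<Prod>e\<in>E. thin_factor (p e) (exp (2 * J e)) (e \<in> \<omega>) (e \<in> agreement E \<sigma>)) = 0"
    using assms by (intro prod_zero) (auto simp: thin_factor_def)
  moreover have "\<omega> \<notin> set_pmf (bernoulli_percolation (agreement E \<sigma>) p)"
    using False set_bernoulli_percolation by blast
  ultimately show ?thesis
    by (simp add: set_pmf_iff)
qed

text \<open>The passage from measures to finite sums: \<open>thin_weight\<close> is the unnormalised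
  mass of a thinned configuration, and both parts of the theorem are proved on such sums.\<close>

lemma expectation_thinning:
  fixes f :: "'a set set \<Rightarrow> real"
  assumes V: "finite V" and E: "finite E" and p: "\<And>e. e \<in> E \<Longrightarrow> 0 \<le> p e \<and> p e \<le> 1"
  shows "measure_pmf.expectation (thinning E p (energy_field V E J)) f =
    (\<Sum>\<omega>\<in>Pow E. f \<omega> * thin_weight V E J p \<omega>) / ising_partition V E J"
proof -
  let ?S = "spin_configs V" and ?B = "\<lambda>\<xi>. bernoulli_percolation \<xi> p"
  let ?M = "ising V E J" and ?Z = "ising_partition V E J" and ?\<xi> = "agreement E"
  have bern: "measure_pmf.expectation (?B \<xi>) g = (\<Sum>\<omega>\<in>Pow E. g \<omega> * pmf (?B \<xi>) \<omega>)"
    if "\<xi> \<subseteq> E" for g :: "'a set set \<Rightarrow> real" and \<xi>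
    using E that set_bernoulli_percolation[of \<xi> p]
    by (intro integral_measure_pmf_real) auto
  have spin: "\<sigma> \<in> ?S" if "\<sigma> \<in> set_pmf ?M" for \<sigma>
    using that pmf_ising[OF V, of E J \<sigma>] by (auto simp: set_pmf_iff split: if_splits)
  have "thinning E p (energy_field V E J) =
      map_pmf (\<lambda>(\<sigma>, \<eta>). ?\<xi> \<sigma> \<inter> \<eta>) (pair_pmf ?M (?B E))"
    unfolding thinning_def energy_field_def pair_map_pmf1 map_pmf_comp
    by (simp add: case_prod_unfold)
  then have "measure_pmf.expectation (thinning E p (energy_field V E J)) f =
      measure_pmf.expectation (pair_pmf ?M (?B E)) (\<lambda>(\<sigma>, \<eta>). f (?\<xi> \<sigma> \<inter> \<eta>))"
    by (simp add: case_prod_unfold)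
  also have "\<dots> = (\<Sum>z\<in>?S \<times> Pow E. (case z of (\<sigma>, \<eta>) \<Rightarrow> f (?\<xi> \<sigma> \<inter> \<eta>)) * pmf (pair_pmf ?M (?B E)) z)"
    using spin set_bernoulli_percolation[of E p] finite_spin_configs[OF V] E
    by (intro integral_measure_pmf_real) auto
  also have "\<dots> = (\<Sum>\<sigma>\<in>?S. \<Sum>\<eta>\<in>Pow E. f (?\<xi> \<sigma> \<inter> \<eta>) * (pmf ?M \<sigma> * pmf (?B E) \<eta>))"
    by (simp only: sum.cartesian_product' prod.case pmf_pair)
  also have "\<dots> = (\<Sum>\<sigma>\<in>?S. pmf ?M \<sigma> * (\<Sum>\<eta>\<in>Pow E. f (?\<xi> \<sigma> \<inter> \<eta>) * pmf (?B E) \<eta>))"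
    by (simp only: sum_distrib_left mult.left_commute)
  also have "\<dots> = (\<Sum>\<sigma>\<in>?S. pmf ?M \<sigma> * (\<Sum>\<omega>\<in>Pow E. f \<omega> * pmf (?B (?\<xi> \<sigma>)) \<omega>))"
  proof (rule sum.cong[OF refl], rule arg_cong2[where f = "(*)", OF refl])
    fix \<sigma>
    have "(\<Sum>\<eta>\<in>Pow E. f (?\<xi> \<sigma> \<inter> \<eta>) * pmf (?B E) \<eta>) =
        measure_pmf.expectation (map_pmf ((\<inter>) (?\<xi> \<sigma>)) (?B E)) f"
      unfolding integral_map_pmf by (rule bern[OF order_refl, symmetric])
    also have "\<dots> = (\<Sum>\<omega>\<in>Pow E. f \<omega> * pmf (?B (?\<xi> \<sigma>)) \<omega>)"
      unfolding bernoulli_percolation_inter[OF E agreement_subset] by (rule bern[OF agreement_subset])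
    finally show "(\<Sum>\<eta>\<in>Pow E. f (?\<xi> \<sigma> \<inter> \<eta>) * pmf (?B E) \<eta>) =
        (\<Sum>\<omega>\<in>Pow E. f \<omega> * pmf (?B (?\<xi> \<sigma>)) \<omega>)" .
  qed
  also have "\<dots> = (\<Sum>\<sigma>\<in>?S. \<Sum>\<omega>\<in>Pow E. f \<omega> * (ising_weight E J \<sigma> * pmf (?B (?\<xi> \<sigma>)) \<omega>)) / ?Z"
    unfolding sum_divide_distrib sum_distrib_left
    by (intro sum.cong refl) (simp add: pmf_ising[OF V])
  also have "(\<Sum>\<sigma>\<in>?S. \<Sum>\<omega>\<in>Pow E. f \<omega> * (ising_weight E J \<sigma> * pmf (?B (?\<xi> \<sigma>)) \<omega>)) =
      (\<Sum>\<omega>\<in>Pow E. f \<omega> * thin_weight V E J p \<omega>)"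
    unfolding thin_weight_def sum_distrib_left
    by (subst sum.swap, intro sum.cong refl) (simp add: ising_weight_times_pmf[OF E p])
  finally show ?thesis .
qed

lemma ising_partition_eq_sum_thin_weight:
  assumes "finite V" "finite E" "\<And>e. e \<in> E \<Longrightarrow> 0 \<le> p e \<and> p e \<le> 1"
  shows "ising_partition V E J = (\<Sum>\<omega>\<in>Pow E. thin_weight V E J p \<omega>)"
  using expectation_thinning[OF assms, where J = J and f = "\<lambda>_. 1"] ising_partition_pos[OF assms(1), of E J]
  by simp

lemma prob_thinning:
  assumes "finite V" "finite E" "\<And>e. e \<in> E \<Longrightarrow> 0 \<le> p e \<and> p e \<le> 1"
  shows "measure_pmf.prob (thinning E p (energy_field V E J)) A =
    (\<Sum>\<omega>\<in>Pow E. indicator A \<omega> * thin_weight V E J p \<omega>) / ising_partition V E J"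
  using expectation_thinning[OF assms, where J = J and f = "indicator A"] by simp

subsection \<open>Random-cluster expansion\<close>

text \<open>The increments of \<open>thin_factor\<close> in \<open>t\<close>: the two values add up
  to \<open>thin_factor p a s True\<close>, and the value at \<open>False\<close> is unchanged. Here
  \<open>t\<close> means membership in the larger set \<theta>.\<close>

definition fk_factor :: "real \<Rightarrow> real \<Rightarrow> bool \<Rightarrow> bool \<Rightarrow> real" where
  "fk_factor p a s t = (if t then a * (if s then p else 1 - p) - of_bool (\<not> s) else of_bool (\<not> s))"

lemma fk_factor_nonneg:
  assumes "0 \<le> p" "0 \<le> a" "1 \<le> a * (1 - p)"
  shows "0 \<le> fk_factor p a s t"
  using assms by (simp add: fk_factor_def)

text \<open>Comparable pairs give equality. The only incomparable pair is
  \<open>(True, False)\<close>, \<open>(False, True)\<close>, where the left side is zero because a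
  surviving edge must belong to \<theta>.\<close>

lemma fk_factor_mult_le:
  assumes "0 \<le> p" "0 \<le> a" "1 \<le> a * (1 - p)"
  shows "fk_factor p a s t * fk_factor p a s' t'
    \<le> fk_factor p a (s \<or> s') (t \<or> t') * fk_factor p a (s \<and> s') (t \<and> t')"
  using assms by (cases s; cases t; cases s'; cases t') (simp_all add: fk_factor_def)

text \<open>The substitute for \<open>num_agreeing\<close> after raising the coupling from
  \<open>J\<close> to \<open>J'\<close>; the factor \<open>1 + c e\<close> then stands for
  \<open>exp (2 * (J' e - J e))\<close>.\<close>

definition tilted_agreeing ::
  "'a set \<Rightarrow> 'a set set \<Rightarrow> ('a set \<Rightarrow> real) \<Rightarrow> 'a set set \<Rightarrow> real" where
  "tilted_agreeing V E c \<theta> = (\<Sum>\<sigma>\<in>spin_configs V. of_bool (\<theta> \<subseteq> agreement E \<sigma>) *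
     (\<Prod>e\<in>E. if e \<in> agreement E \<sigma> then 1 + c e else 1))"

text \<open>Expanding the factors \<open>1 + c e\<close> over sets \<open>T\<close> of agreeing
  edges merges the two inclusions into
  \<open>\<theta> \<union> T \<subseteq> agreement E \<sigma>\<close>.\<close>

lemma tilted_agreeing_eq_sum:
  assumes "finite V" "finite E"
  shows "tilted_agreeing V E c \<theta> =
    (\<Sum>T\<in>Pow E. (\<Prod>e\<in>E. if e \<in> T then c e else 1) * num_agreeing V E (\<theta> \<union> T))"
proof -
  have "tilted_agreeing V E c \<theta> = (\<Sum>\<sigma>\<in>spin_configs V. \<Sum>T\<in>Pow E.
      (\<Prod>e\<in>E. if e \<in> T then c e else 1) * of_bool (\<theta> \<union> T \<subseteq> agreement E \<sigma>))"
    unfolding tilted_agreeing_def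
  proof (intro sum.cong refl)
    fix \<sigma>
    have "(\<Prod>e\<in>E. if e \<in> agreement E \<sigma> then 1 + c e else 1) =
        (\<Sum>T\<in>Pow E. of_bool (T \<subseteq> agreement E \<sigma>) * (\<Prod>e\<in>E. if e \<in> T then c e else 1))"
      using prod_if_eq_sum_Pow[OF assms(2), of "agreement E \<sigma>" "\<lambda>e t. if t then c e else 1"]
      by (simp add: add.commute cong: if_cong)
    then show "of_bool (\<theta> \<subseteq> agreement E \<sigma>) * (\<Prod>e\<in>E. if e \<in> agreement E \<sigma> then 1 + c e else 1) =
        (\<Sum>T\<in>Pow E. (\<Prod>e\<in>E. if e \<in> T then c e else 1) * of_bool (\<theta> \<union> T \<subseteq> agreement E \<sigma>))"
      by (simp add: sum_distrib_left of_bool_conj mult_ac)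
  qed
  also have "\<dots> = (\<Sum>T\<in>Pow E. (\<Prod>e\<in>E. if e \<in> T then c e else 1) *
      (\<Sum>\<sigma>\<in>spin_configs V. of_bool (\<theta> \<union> T \<subseteq> agreement E \<sigma>)))"
    unfolding sum_distrib_left by (rule sum.swap)
  also have "\<dots> = (\<Sum>T\<in>Pow E. (\<Prod>e\<in>E. if e \<in> T then c e else 1) * num_agreeing V E (\<theta> \<union> T))"
    using finite_spin_configs[OF assms(1)] by (simp add: num_agreeing_def Int_def)
  finally show ?thesis .
qed

lemma tilted_agreeing_zero:
  assumes "finite V"
  shows "tilted_agreeing V E (\<lambda>_. 0) \<theta> = num_agreeing V E \<theta>"
  using finite_spin_configs[OF assms]
  by (simp add: tilted_agreeing_def num_agreeing_def Int_def cong: if_cong)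

text \<open>Holds term by term in \<open>T\<close>: supermodularity leaves
  \<open>(\<theta> \<union> T) \<inter> \<theta>'\<close>, which contains
  \<open>\<theta> \<inter> \<theta>'\<close>, and \<open>num_agreeing\<close> is antitone.\<close>

lemma tilted_agreeing_supermodular:
  assumes "finite V" "finite E" "\<And>e. e \<in> E \<Longrightarrow> e \<subseteq> V" "\<And>e. e \<in> E \<Longrightarrow> 0 \<le> c e"
  shows "tilted_agreeing V E c \<theta> * num_agreeing V E \<theta>'
    \<le> tilted_agreeing V E c (\<theta> \<union> \<theta>') * num_agreeing V E (\<theta> \<inter> \<theta>')"
proof -
  have "num_agreeing V E (\<theta> \<union> T) * num_agreeing V E \<theta>'
      \<le> num_agreeing V E (\<theta> \<union> \<theta>' \<union> T) * num_agreeing V E (\<theta> \<inter> \<theta>')" for T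
  proof -
    have "num_agreeing V E (\<theta> \<union> T) * num_agreeing V E \<theta>'
        \<le> num_agreeing V E (\<theta> \<union> T \<union> \<theta>') * num_agreeing V E ((\<theta> \<union> T) \<inter> \<theta>')"
      by (rule num_agreeing_supermodular[OF assms(1,3)])
    also have "\<dots> \<le> num_agreeing V E (\<theta> \<union> T \<union> \<theta>') * num_agreeing V E (\<theta> \<inter> \<theta>')"
      by (intro mult_left_mono num_agreeing_antimono assms(1)) (auto simp: num_agreeing_def)
    finally show ?thesis
      by (simp add: Un_ac)
  qed
  moreover have "0 \<le> (\<Prod>e\<in>E. if e \<in> T then c e else 1)" for T
    using assms(4) by (intro prod_nonneg) auto
  ultimately show ?thesis
    unfolding tilted_agreeing_eq_sum[OF assms(1,2)] sum_distrib_right mult.assoc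
    by (intro sum_mono mult_left_mono) auto
qed

text \<open>Only the weight at the reference coupling \<open>J\<close> is split; the excess of
  \<open>J'\<close> over \<open>J\<close> goes into the tilt. Thus both couplings share the same
  \<open>fk_factor\<close>, and \<open>J' = J\<close> gives the plain random-cluster
  expansion.\<close>

lemma thin_weight_eq_sum:
  assumes "finite E"
  shows "thin_weight V E J' p \<omega> = (\<Sum>\<theta>\<in>Pow E.
    (\<Prod>e\<in>E. fk_factor (p e) (exp (2 * J e)) (e \<in> \<omega>) (e \<in> \<theta>)) *
    tilted_agreeing V E (\<lambda>e. exp (2 * (J' e - J e)) - 1) \<theta>)"
proof -
  let ?a = "\<lambda>e. exp (2 * J e)" and ?c = "\<lambda>e. exp (2 * (J' e - J e)) - 1"
  let ?fk = "\<lambda>\<theta>. \<Prod>e\<in>E. fk_factor (p e) (?a e) (e \<in> \<omega>) (e \<in> \<theta>)"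
  have "thin_weight V E J' p \<omega> = (\<Sum>\<sigma>\<in>spin_configs V. \<Sum>\<theta>\<in>Pow E. ?fk \<theta> *
      (of_bool (\<theta> \<subseteq> agreement E \<sigma>) * (\<Prod>e\<in>E. if e \<in> agreement E \<sigma> then 1 + ?c e else 1)))"
    unfolding thin_weight_def
  proof (intro sum.cong refl)
    fix \<sigma>
    let ?\<xi> = "agreement E \<sigma>"
    have "(\<Prod>e\<in>E. thin_factor (p e) (exp (2 * J' e)) (e \<in> \<omega>) (e \<in> ?\<xi>)) =
        (\<Prod>e\<in>E. thin_factor (p e) (?a e) (e \<in> \<omega>) (e \<in> ?\<xi>)) *
        (\<Prod>e\<in>E. if e \<in> ?\<xi> then 1 + ?c e else 1)"
      unfolding prod.distrib[symmetric]
      by (intro prod.cong refl) (simp add: thin_factor_def right_diff_distrib flip: exp_add)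
    also have "(\<Prod>e\<in>E. thin_factor (p e) (?a e) (e \<in> \<omega>) (e \<in> ?\<xi>)) =
        (\<Prod>e\<in>E. if e \<in> ?\<xi> then fk_factor (p e) (?a e) (e \<in> \<omega>) True + fk_factor (p e) (?a e) (e \<in> \<omega>) False
          else fk_factor (p e) (?a e) (e \<in> \<omega>) False)"
      by (intro prod.cong refl) (simp add: thin_factor_def fk_factor_def)
    also have "\<dots> = (\<Sum>\<theta>\<in>Pow E. of_bool (\<theta> \<subseteq> ?\<xi>) * ?fk \<theta>)"
      by (rule prod_if_eq_sum_Pow[OF assms])
    finally show "(\<Prod>e\<in>E. thin_factor (p e) (exp (2 * J' e)) (e \<in> \<omega>) (e \<in> ?\<xi>)) = (\<Sum>\<theta>\<in>Pow E. ?fk \<theta> *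
      (of_bool (\<theta> \<subseteq> ?\<xi>) * (\<Prod>e\<in>E. if e \<in> ?\<xi> then 1 + ?c e else 1)))"
      unfolding sum_distrib_right by (simp only: mult_ac)
  qed
  also have "\<dots> = (\<Sum>\<theta>\<in>Pow E. ?fk \<theta> * tilted_agreeing V E ?c \<theta>)"
    unfolding tilted_agreeing_def sum_distrib_left by (rule sum.swap)
  finally show ?thesis .
qed

lemma thin_weight_nonneg:
  assumes "\<And>e. e \<in> E \<Longrightarrow> 0 \<le> p e \<and> p e \<le> 1"
  shows "0 \<le> thin_weight V E J p \<omega>"
  unfolding thin_weight_def thin_factor_def using assms
  by (intro sum_nonneg prod_nonneg) auto

lemma thin_weight_supermodular:
  assumes V: "finite V" and E: "finite E" "\<And>e. e \<in> E \<Longrightarrow> e \<subseteq> V"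
    and p: "\<And>e. e \<in> E \<Longrightarrow> 0 \<le> p e" "\<And>e. e \<in> E \<Longrightarrow> p e \<le> 1 - exp (- 2 * J e)"
    and J': "\<And>e. e \<in> E \<Longrightarrow> J e \<le> J' e"
  shows "thin_weight V E J' p A * thin_weight V E J p B
    \<le> thin_weight V E J' p (A \<union> B) * thin_weight V E J p (A \<inter> B)"
proof -
  let ?fk = "\<lambda>\<omega> \<theta>. \<Prod>e\<in>E. fk_factor (p e) (exp (2 * J e)) (e \<in> \<omega>) (e \<in> \<theta>)"
  let ?c = "\<lambda>e. exp (2 * (J' e - J e)) - 1"
  \<comment> \<open>The bound on \<open>p\<close> in the form that makes \<open>fk_factor\<close>
    nonnegative.\<close>
  have p_le: "1 \<le> exp (2 * J e) * (1 - p e)" if "e \<in> E" for e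
  proof -
    have "exp (2 * J e) * exp (- 2 * J e) \<le> exp (2 * J e) * (1 - p e)"
      using p(2)[OF that] by (intro mult_left_mono) auto
    then show ?thesis
      by (simp flip: exp_add)
  qed
  have c: "0 \<le> ?c e" if "e \<in> E" for e
    using J'[OF that] by simp
  have fk_nonneg: "0 \<le> ?fk \<omega> \<theta>" for \<omega> \<theta>
    using p(1) p_le by (intro prod_nonneg) (auto intro!: fk_factor_nonneg)
  have fk_le: "?fk A \<theta> * ?fk B \<theta>' \<le> ?fk (A \<union> B) (\<theta> \<union> \<theta>') * ?fk (A \<inter> B) (\<theta> \<inter> \<theta>')" for \<theta> \<theta>'
    unfolding prod.distrib[symmetric] Un_iff Int_iff using p(1) p_le
    by (intro prod_mono conjI fk_factor_mult_le mult_nonneg_nonneg fk_factor_nonneg) auto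
  have N_nonneg: "0 \<le> num_agreeing V E \<theta>" for \<theta>
    by (simp add: num_agreeing_def)
  have G_nonneg: "0 \<le> tilted_agreeing V E ?c \<theta>" for \<theta>
    unfolding tilted_agreeing_def by (intro sum_nonneg mult_nonneg_nonneg prod_nonneg) auto
  have "thin_weight V E J p \<omega> = (\<Sum>\<theta>\<in>Pow E. ?fk \<omega> \<theta> * num_agreeing V E \<theta>)" for \<omega>
    using thin_weight_eq_sum[OF E(1), of V J p \<omega> J] by (simp add: tilted_agreeing_zero[OF V])
  \<comment> \<open>With \<open>A\<close> and \<open>B\<close> fixed, the four functions theorem is
    applied in the variable \<theta>.\<close>
  moreover have "(\<Sum>\<theta>\<in>Pow E. ?fk A \<theta> * tilted_agreeing V E ?c \<theta>) * (\<Sum>\<theta>\<in>Pow E. ?fk B \<theta> * num_agreeing V E \<theta>)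
      \<le> (\<Sum>\<theta>\<in>Pow E. ?fk (A \<union> B) \<theta> * tilted_agreeing V E ?c \<theta>) * (\<Sum>\<theta>\<in>Pow E. ?fk (A \<inter> B) \<theta> * num_agreeing V E \<theta>)"
  proof (rule four_functions[OF E(1)])
    fix \<theta> \<theta>'
    have "(?fk A \<theta> * ?fk B \<theta>') * (tilted_agreeing V E ?c \<theta> * num_agreeing V E \<theta>')
        \<le> (?fk (A \<union> B) (\<theta> \<union> \<theta>') * ?fk (A \<inter> B) (\<theta> \<inter> \<theta>')) *
          (tilted_agreeing V E ?c (\<theta> \<union> \<theta>') * num_agreeing V E (\<theta> \<inter> \<theta>'))"
      by (intro mult_mono[OF fk_le tilted_agreeing_supermodular[OF V E c]] mult_nonneg_nonneg
          fk_nonneg N_nonneg G_nonneg)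
    then show "?fk A \<theta> * tilted_agreeing V E ?c \<theta> * (?fk B \<theta>' * num_agreeing V E \<theta>')
        \<le> ?fk (A \<union> B) (\<theta> \<union> \<theta>') * tilted_agreeing V E ?c (\<theta> \<union> \<theta>') *
          (?fk (A \<inter> B) (\<theta> \<inter> \<theta>') * num_agreeing V E (\<theta> \<inter> \<theta>'))"
      by (simp only: mult_ac)
  qed (intro mult_nonneg_nonneg fk_nonneg N_nonneg G_nonneg)+
  ultimately show ?thesis
    by (simp only: thin_weight_eq_sum[OF E(1), of V J' p _ J])
qed

section \<open>Weak FKG property and weak monotonicity for small p\<close>

lemma weak_FKG_energy_field:
  assumes V: "finite V" and E: "finite E" "\<And>e. e \<in> E \<Longrightarrow> e \<subseteq> V"
    and p: "\<And>e. e \<in> E \<Longrightarrow> 0 \<le> p e" "\<And>e. e \<in> E \<Longrightarrow> p e \<le> 1 - exp (- 2 * J e)"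
  shows "weak_FKG E p (energy_field V E J)"
  unfolding weak_FKG_def
proof (intro allI impI)
  fix f g :: "'a set set \<Rightarrow> real"
  assume fg: "mono_on (Pow E) f" "mono_on (Pow E) g"
  let ?w = "thin_weight V E J p" and ?Z = "ising_partition V E J"
  have p01: "0 \<le> p e \<and> p e \<le> 1" if "e \<in> E" for e
    using p[OF that] exp_gt_zero[of "- 2 * J e"] by linarith
  \<comment> \<open>The lattice condition is \<open>thin_weight_supermodular\<close> with
    \<open>J' = J\<close>.\<close>
  have "(\<Sum>A\<in>Pow E. f A * ?w A) * (\<Sum>A\<in>Pow E. g A * ?w A)
      \<le> (\<Sum>A\<in>Pow E. f A * g A * ?w A) * (\<Sum>A\<in>Pow E. ?w A)"
    using fg by (intro FKG_inequality thin_weight_supermodular thin_weight_nonneg V E p p01 order_refl)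
  also have "(\<Sum>A\<in>Pow E. ?w A) = ?Z"
    by (rule ising_partition_eq_sum_thin_weight[OF V E(1) p01, symmetric])
  finally show "measure_pmf.expectation (thinning E p (energy_field V E J)) (\<lambda>\<omega>. f \<omega> * g \<omega>)
      \<ge> measure_pmf.expectation (thinning E p (energy_field V E J)) f *
        measure_pmf.expectation (thinning E p (energy_field V E J)) g"
    using ising_partition_pos[OF V, of E J]
    by (simp add: expectation_thinning[OF V E(1) p01] field_simps)
qed

lemma weakly_dominated_energy_field:
  assumes V: "finite V" and E: "finite E" "\<And>e. e \<in> E \<Longrightarrow> e \<subseteq> V"
    and p: "\<And>e. e \<in> E \<Longrightarrow> 0 \<le> p e" "\<And>e. e \<in> E \<Longrightarrow> p e \<le> 1 - exp (- 2 * J e)"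
    and J': "\<And>e. e \<in> E \<Longrightarrow> J e \<le> J' e"
  shows "weakly_dominated E p (energy_field V E J) (energy_field V E J')"
  unfolding weakly_dominated_def stoch_dominated_def
proof (intro allI impI)
  fix A assume A: "increasing_event E A"
  let ?w = "\<lambda>J. thin_weight V E J p" and ?Z = "ising_partition V E"
  have p01: "0 \<le> p e \<and> p e \<le> 1" if "e \<in> E" for e
    using p[OF that] exp_gt_zero[of "- 2 * J e"] by linarith
  have "mono_on (Pow E) (indicator A :: 'a set set \<Rightarrow> real)"
    using A by (auto simp: increasing_event_def mono_on_def indicator_def)
  moreover have "mono_on (Pow E) (\<lambda>_. 1 :: real)"
    by (simp add: mono_on_def)
  \<comment> \<open>The constant function 1 in the first slot turns \<open>holley_FKG\<close> into
    Holley's comparison of \<open>J\<close> with \<open>J'\<close>.\<close>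
  ultimately have "(\<Sum>\<omega>\<in>Pow E. 1 * ?w J' \<omega>) * (\<Sum>\<omega>\<in>Pow E. indicator A \<omega> * ?w J \<omega>)
      \<le> (\<Sum>\<omega>\<in>Pow E. 1 * indicator A \<omega> * ?w J' \<omega>) * (\<Sum>\<omega>\<in>Pow E. ?w J \<omega>)"
    by (intro holley_FKG thin_weight_supermodular thin_weight_nonneg V E p p01 J') auto
  then have "?Z J' * (\<Sum>\<omega>\<in>Pow E. indicator A \<omega> * ?w J \<omega>)
      \<le> (\<Sum>\<omega>\<in>Pow E. indicator A \<omega> * ?w J' \<omega>) * ?Z J"
    by (simp add: ising_partition_eq_sum_thin_weight[OF V E(1) p01])
  then show "measure_pmf.prob (thinning E p (energy_field V E J)) A
      \<le> measure_pmf.prob (thinning E p (energy_field V E J')) A"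
    using ising_partition_pos[OF V, of E J] ising_partition_pos[OF V, of E J']
    by (simp add: prob_thinning[OF V E(1) p01] field_simps)
qed

subsection \<open>The energy field on a cycle\<close>

lemma sum_spin_configs_insert:
  fixes F :: "('a \<Rightarrow> int) \<Rightarrow> real"
  assumes "x \<notin> S"
  shows "(\<Sum>\<sigma>\<in>spin_configs (insert x S). F \<sigma>) =
    (\<Sum>\<sigma>\<in>spin_configs S. F (\<sigma>(x := 1)) + F (\<sigma>(x := -1)))"
proof -
  let ?f = "\<lambda>(y, \<sigma>). \<sigma>(x := y)"
  have inj: "inj_on ?f ({-1, 1} \<times> spin_configs S)"
    using inj_combinator[OF assms, of "\<lambda>_. {-1, 1 :: int}"] by (simp add: spin_configs_def)
  have "(\<Sum>\<sigma>\<in>spin_configs (insert x S). F \<sigma>) = (\<Sum>z\<in>{-1, 1} \<times> spin_configs S. F (?f z))"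
    using sum.reindex[OF inj, of F] by (simp add: spin_configs_def PiE_insert_eq comp_def)
  also have "\<dots> = (\<Sum>y\<in>{-1, 1}. \<Sum>\<sigma>\<in>spin_configs S. F (\<sigma>(x := y)))"
    by (simp only: sum.cartesian_product' prod.case)
  finally show ?thesis
    by (simp add: sum.distrib add.commute)
qed

text \<open>The transfer matrices of a path commute, with eigenvalues \<open>\<phi> k True \<plusminus> \<phi> k False\<close>.\<close>

lemma sum_spin_configs_path:
  fixes \<phi> :: "nat \<Rightarrow> bool \<Rightarrow> real" and g :: "bool \<Rightarrow> real"
  shows "(\<Sum>\<sigma>\<in>spin_configs {0..m}. (\<Prod>k=1..m. \<phi> k (\<sigma> (k - 1) = \<sigma> k)) * g (\<sigma> 0 = \<sigma> m)) =
    (\<Prod>k=1..m. \<phi> k True + \<phi> k False) * (g True + g False) +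
    (\<Prod>k=1..m. \<phi> k True - \<phi> k False) * (g True - g False)"
proof (induction m arbitrary: g)
  case 0
  have "spin_configs {} = {\<lambda>_::nat. undefined}"
    by (simp add: spin_configs_def)
  then show ?case
    using sum_spin_configs_insert[of "0 :: nat" "{}" "\<lambda>_. g True"] by simp
next
  case (Suc m)
  let ?P = "\<lambda>\<sigma>. \<Prod>k=1..m. \<phi> k (\<sigma> (k - 1) = \<sigma> k)"
  \<comment> \<open>Result of summing out the last spin: as spins take two values, a disagreement on
    the last step negates the comparison with \<open>\<sigma> 0\<close>.\<close>
  define g' where "g' b = \<phi> (Suc m) True * g b + \<phi> (Suc m) False * g (\<not> b)" for b
  have "(\<Sum>\<sigma>\<in>spin_configs {0..Suc m}. (\<Prod>k=1..Suc m. \<phi> k (\<sigma> (k - 1) = \<sigma> k)) * g (\<sigma> 0 = \<sigma> (Suc m)))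
      = (\<Sum>\<sigma>\<in>spin_configs {0..m}. ?P \<sigma> * g' (\<sigma> 0 = \<sigma> m))"
    unfolding atLeast0_atMost_Suc
  proof (subst sum_spin_configs_insert, simp, intro sum.cong refl)
    fix \<sigma> assume "\<sigma> \<in> spin_configs {0..m}"
    then have spin: "\<sigma> 0 = 1 \<or> \<sigma> 0 = -1" "\<sigma> m = 1 \<or> \<sigma> m = -1"
      by (auto simp: spin_configs_def PiE_iff)
    have eq: "(\<Prod>k=1..Suc m. \<phi> k ((\<sigma>(Suc m := y)) (k - 1) = (\<sigma>(Suc m := y)) k)) =
        ?P \<sigma> * \<phi> (Suc m) (\<sigma> m = y)" for y
    proof -
      have "(\<Prod>k=1..m. \<phi> k ((\<sigma>(Suc m := y)) (k - 1) = (\<sigma>(Suc m := y)) k)) = ?P \<sigma>"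
        by (rule prod.cong) auto
      then show ?thesis
        by simp
    qed
    show "(\<Prod>k=1..Suc m. \<phi> k ((\<sigma>(Suc m := 1)) (k - 1) = (\<sigma>(Suc m := 1)) k)) *
          g ((\<sigma>(Suc m := 1)) 0 = (\<sigma>(Suc m := 1)) (Suc m)) +
        (\<Prod>k=1..Suc m. \<phi> k ((\<sigma>(Suc m := -1)) (k - 1) = (\<sigma>(Suc m := -1)) k)) *
          g ((\<sigma>(Suc m := -1)) 0 = (\<sigma>(Suc m := -1)) (Suc m)) = ?P \<sigma> * g' (\<sigma> 0 = \<sigma> m)"
      unfolding eq g'_def using spin by (elim disjE) (simp_all add: algebra_simps)
  qed
  also have "\<dots> = (\<Prod>k=1..m. \<phi> k True + \<phi> k False) * (g' True + g' False) +
    (\<Prod>k=1..m. \<phi> k True - \<phi> k False) * (g' True - g' False)"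
    by (rule Suc.IH)
  also have "g' True + g' False = (\<phi> (Suc m) True + \<phi> (Suc m) False) * (g True + g False)"
    by (simp add: g'_def algebra_simps)
  also have "g' True - g' False = (\<phi> (Suc m) True - \<phi> (Suc m) False) * (g True - g False)"
    by (simp add: g'_def algebra_simps)
  finally show ?case
    by (simp add: mult.assoc)
qed

text \<open>The closing edge has number \<open>n + 1\<close>, the coordinate whose coupling may be
  chosen freely.\<close>

definition cycle_edge :: "nat \<Rightarrow> nat \<Rightarrow> nat set" where
  "cycle_edge n k = (if k = n + 1 then {0, n} else {k - 1, k})"

definition cycle_edges :: "nat \<Rightarrow> nat set set" where
  "cycle_edges n = cycle_edge n ` {1..n+1}"

definition on_cycle :: "nat \<Rightarrow> (nat \<Rightarrow> 'b) \<Rightarrow> nat set \<Rightarrow> 'b" where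
  "on_cycle n f e = f (inv_into {1..n+1} (cycle_edge n) e)"

text \<open>For \<open>n = 1\<close> the closing edge would coincide with edge 1.\<close>

lemma inj_on_cycle_edge:
  assumes "2 \<le> n"
  shows "inj_on (cycle_edge n) {1..n+1}"
  using assms by (auto simp: inj_on_def cycle_edge_def doubleton_eq_iff split: if_splits)

lemma on_cycle_cycle_edge:
  assumes "2 \<le> n" "k \<in> {1..n+1}"
  shows "on_cycle n f (cycle_edge n k) = f k"
  unfolding on_cycle_def using inj_on_cycle_edge[OF assms(1)] assms(2) by simp

lemma finite_graph_cycle:
  assumes "2 \<le> n"
  shows "finite_graph {0..n} (cycle_edges n)"
  using assms by (auto simp: finite_graph_def cycle_edges_def cycle_edge_def)

lemma cycle_edge_in_agreement:
  assumes "k \<in> {1..n+1}"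
  shows "cycle_edge n k \<in> agreement (cycle_edges n) \<sigma> \<longleftrightarrow>
    (if k = n + 1 then \<sigma> 0 = \<sigma> n else \<sigma> (k - 1) = \<sigma> k)"
  using assms by (auto simp: agreement_def cycle_edges_def cycle_edge_def)

lemma prod_cycle_edges:
  assumes "2 \<le> n"
  shows "(\<Prod>e\<in>cycle_edges n. F e) = (\<Prod>k=1..n. F (cycle_edge n k)) * F (cycle_edge n (n + 1))"
  unfolding cycle_edges_def prod.reindex[OF inj_on_cycle_edge[OF assms]]
  by (simp add: mult.commute)

text \<open>For a test function that is a product over edges, the sum over \<omega> factorises once
  the spins are fixed, with edge factors \<open>H\<close>. What remains is a path sum in which the
  closing edge compares the two end spins.\<close>

lemma sum_thin_weight_cycle:
  fixes J p :: "nat \<Rightarrow> real" and h :: "nat \<Rightarrow> bool \<Rightarrow> real"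
  assumes "2 \<le> n"
  defines "H \<equiv> \<lambda>k t. if t then exp (2 * J k) * (p k * h k True + (1 - p k) * h k False) else h k False"
  shows "(\<Sum>\<omega>\<in>Pow (cycle_edges n).
      ((\<Prod>k=1..n. h k (cycle_edge n k \<in> \<omega>)) * h (n + 1) (cycle_edge n (n + 1) \<in> \<omega>)) *
      thin_weight {0..n} (cycle_edges n) (on_cycle n J) (on_cycle n p) \<omega>) =
    (\<Prod>k=1..n. H k True + H k False) * (H (n + 1) True + H (n + 1) False) +
    (\<Prod>k=1..n. H k True - H k False) * (H (n + 1) True - H (n + 1) False)"
proof -
  let ?E = "cycle_edges n" and ?e = "cycle_edge n" and ?S = "spin_configs {0..n}"
  let ?F = "\<lambda>\<sigma> e s. on_cycle n h e s * thin_factor (on_cycle n p e) (exp (2 * on_cycle n J e)) s (e \<in> agreement ?E \<sigma>)"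
  note [simp] = on_cycle_cycle_edge[OF assms(1)]
  have fin: "finite ?E"
    by (simp add: cycle_edges_def)
  have "(\<Sum>\<omega>\<in>Pow ?E. ((\<Prod>k=1..n. h k (?e k \<in> \<omega>)) * h (n + 1) (?e (n + 1) \<in> \<omega>)) *
      thin_weight {0..n} ?E (on_cycle n J) (on_cycle n p) \<omega>) =
      (\<Sum>\<omega>\<in>Pow ?E. (\<Prod>e\<in>?E. on_cycle n h e (e \<in> \<omega>)) *
      thin_weight {0..n} ?E (on_cycle n J) (on_cycle n p) \<omega>)"
    by (intro sum.cong refl) (simp add: prod_cycle_edges[OF assms(1)])
  also have "\<dots> = (\<Sum>\<sigma>\<in>?S. \<Sum>\<omega>\<in>Pow ?E. \<Prod>e\<in>?E. ?F \<sigma> e (e \<in> \<omega>))"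
    unfolding thin_weight_def sum_distrib_left prod.distrib by (rule sum.swap)
  also have "\<dots> = (\<Sum>\<sigma>\<in>?S. \<Prod>e\<in>?E. ?F \<sigma> e True + ?F \<sigma> e False)"
    by (intro sum.cong refl prod_add_eq_sum_Pow[OF fin, symmetric])
  also have "\<dots> = (\<Sum>\<sigma>\<in>?S. (\<Prod>k=1..n. H k (\<sigma> (k - 1) = \<sigma> k)) * H (n + 1) (\<sigma> 0 = \<sigma> n))"
  proof (intro sum.cong refl)
    fix \<sigma>
    have "?F \<sigma> (?e k) True + ?F \<sigma> (?e k) False = H k (if k = n + 1 then \<sigma> 0 = \<sigma> n else \<sigma> (k - 1) = \<sigma> k)"
      if "k \<in> {1..n+1}" for k
      unfolding cycle_edge_in_agreement[OF that]
      using that by (simp add: H_def thin_factor_def algebra_simps)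
    then show "(\<Prod>e\<in>?E. ?F \<sigma> e True + ?F \<sigma> e False) =
        (\<Prod>k=1..n. H k (\<sigma> (k - 1) = \<sigma> k)) * H (n + 1) (\<sigma> 0 = \<sigma> n)"
      unfolding prod_cycle_edges[OF assms(1)] by (intro arg_cong2[where f = "(*)"] prod.cong) auto
  qed
  also have "\<dots> = (\<Prod>k=1..n. H k True + H k False) * (H (n + 1) True + H (n + 1) False) +
    (\<Prod>k=1..n. H k True - H k False) * (H (n + 1) True - H (n + 1) False)"
    by (rule sum_spin_configs_path)
  finally show ?thesis .
qed

section \<open>The event that at most one path edge is closed\<close>

definition almost_open :: "nat \<Rightarrow> nat set set set" where
  "almost_open n = {\<omega> \<in> Pow (cycle_edges n). card {k \<in> {1..n}. cycle_edge n k \<notin> \<omega>} \<le> 1}"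

lemma increasing_almost_open: "increasing_event (cycle_edges n) (almost_open n)"
  unfolding increasing_event_def
proof (intro conjI ballI impI)
  fix \<omega> \<omega>' assume *: "\<omega> \<in> almost_open n" "\<omega>' \<in> Pow (cycle_edges n)" "\<omega> \<subseteq> \<omega>'"
  then have "card {k \<in> {1..n}. cycle_edge n k \<notin> \<omega>'} \<le> card {k \<in> {1..n}. cycle_edge n k \<notin> \<omega>}"
    by (intro card_mono) auto
  with * show "\<omega>' \<in> almost_open n"
    by (simp add: almost_open_def)
qed (auto simp: almost_open_def)

text \<open>The index \<open>j = 0\<close> accounts for the configurations in which all of the first \<open>n\<close> edges are
  open, the other indices for those in which exactly edge \<open>j\<close> is closed.\<close>

lemma indicator_almost_open:
  assumes "\<omega> \<subseteq> cycle_edges n"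
  shows "indicator (almost_open n) \<omega> =
    (\<Sum>j=0..n. \<Prod>k=1..n. of_bool ((cycle_edge n k \<in> \<omega>) \<noteq> (k = j)) :: real)"
proof -
  let ?C = "{k \<in> {1..n}. cycle_edge n k \<notin> \<omega>}"
  \<comment> \<open>The product forces the closed path edges to be
    \<open>{j} \<inter> {1..n}\<close>, which is empty for \<open>j = 0\<close>.\<close>
  have prod: "(\<Prod>k=1..n. of_bool ((cycle_edge n k \<in> \<omega>) \<noteq> (k = j)) :: real) =
      of_bool (?C = {j} \<inter> {1..n})" for j
  proof -
    have "?C = {j} \<inter> {1..n} \<longleftrightarrow> (\<forall>k\<in>{1..n}. (cycle_edge n k \<in> \<omega>) \<noteq> (k = j))"
      unfolding set_eq_iff Ball_def by (rule iff_allI) auto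
    also have "(of_bool \<dots> :: real) = (\<Prod>k=1..n. of_bool ((cycle_edge n k \<in> \<omega>) \<noteq> (k = j)))"
      by (cases "\<forall>k\<in>{1..n}. (cycle_edge n k \<in> \<omega>) \<noteq> (k = j)") (auto intro!: prod_zero)
    finally show ?thesis ..
  qed
  have fin: "finite ?C"
    by simp
  consider (none) "?C = {}" | (one) i where "?C = {i}" "i \<in> {1..n}" | (many) "card ?C > 1"
  proof -
    consider "card ?C = 0" | "card ?C = 1" | "card ?C > 1"
      by linarith
    then show thesis
    proof cases
      case 1
      then show thesis
        using that(1) fin by (simp only: card_0_eq)
    next
      case 2
      then obtain i where "?C = {i}"
        by (rule card_1_singletonE)
      then show thesis
        using that(2)[of i] by blast
    qed (rule that(3))
  qed
  then show ?thesis
  proof cases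
    case none
    have "(\<Sum>j=0..n. of_bool (?C = {j} \<inter> {1..n}) :: real) = (\<Sum>j=0..n. if j = 0 then 1 else 0)"
      unfolding none by (intro sum.cong) auto
    moreover have "\<omega> \<in> almost_open n"
      using assms unfolding almost_open_def mem_Collect_eq none by simp
    ultimately show ?thesis
      unfolding prod by simp
  next
    case one
    have "(\<Sum>j=0..n. of_bool (?C = {j} \<inter> {1..n}) :: real) = (\<Sum>j=0..n. if j = i then 1 else 0)"
    proof (intro sum.cong refl)
      fix j
      have "?C = {j} \<inter> {1..n} \<longleftrightarrow> j = i"
      proof
        assume "?C = {j} \<inter> {1..n}"
        then have "{j} \<inter> {1..n} = {i}"
          using one(1) by (rule trans[OF sym])
        then have "i \<in> {j} \<inter> {1..n}"
          by (rule ssubst) (rule singletonI)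
        then show "j = i"
          by simp
      next
        assume "j = i"
        then show "?C = {j} \<inter> {1..n}"
          unfolding one(1) using one(2) by simp
      qed
      then show "(of_bool (?C = {j} \<inter> {1..n}) :: real) = (if j = i then 1 else 0)"
        by (simp only: of_bool_def)
    qed
    moreover have "\<omega> \<in> almost_open n"
      using assms unfolding almost_open_def mem_Collect_eq one(1) by simp
    ultimately show ?thesis
      unfolding prod using one(2) by simp
  next
    case many
    have ne: "?C \<noteq> {j} \<inter> {1..n}" for j
    proof
      assume eq: "?C = {j} \<inter> {1..n}"
      have "card ?C \<le> card {j}"
        unfolding eq by (intro card_mono) auto
      moreover have "card {j} = 1"
        by simp
      ultimately show False
        using many by linarith
    qed
    have "(\<Sum>j=0..n. of_bool (?C = {j} \<inter> {1..n}) :: real) = 0"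
      by (intro sum.neutral ballI) (simp only: ne of_bool_eq)
    moreover have "\<omega> \<notin> almost_open n"
      unfolding almost_open_def mem_Collect_eq using many leD by blast
    ultimately show ?thesis
      unfolding prod by simp
  qed
qed

text \<open>The index 0 replaces no factor and contributes the 1; any other \<open>j\<close>
  contributes the ratio \<open>y j / x j\<close>.\<close>

lemma sum_prod_single_swap:
  fixes x y :: "nat \<Rightarrow> real"
  assumes "\<And>k. k \<in> {1..n} \<Longrightarrow> x k \<noteq> 0"
  shows "(\<Sum>j=0..n. \<Prod>k=1..n. if k = j then y k else x k) = (\<Prod>k=1..n. x k) * (1 + (\<Sum>k=1..n. y k / x k))"
proof -
  have "(\<Prod>k=1..n. if k = j then y k else x k) = (\<Prod>k=1..n. x k) * (y j / x j)" if "j \<in> {1..n}" for j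
  proof -
    have "(\<Prod>k\<in>{1..n} - {j}. if k = j then y k else x k) = (\<Prod>k\<in>{1..n} - {j}. x k)"
      by (intro prod.cong) auto
    then have "(\<Prod>k=1..n. if k = j then y k else x k) = y j * (\<Prod>k\<in>{1..n} - {j}. x k)"
      using prod.remove[OF finite_atLeastAtMost that, of "\<lambda>k. if k = j then y k else x k"] by simp
    moreover have "(\<Prod>k=1..n. x k) = x j * (\<Prod>k\<in>{1..n} - {j}. x k)"
      using that by (intro prod.remove) auto
    ultimately show ?thesis
      using assms[OF that] by simp
  qed
  moreover have "(\<Prod>k=1..n. if k = 0 then y k else x k) = (\<Prod>k=1..n. x k)"
    by (intro prod.cong) auto
  moreover have "{0..n} = insert 0 {1..n}"
    by auto
  ultimately show ?thesis
    by (simp add: distrib_left sum_distrib_left)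
qed

text \<open>An open path edge contributes \<open>a k * p k\<close> to both eigenvalues, a closed one
  \<open>a k * (1 - p k)\<close> plus or minus 1. The observable \<open>l\<close> of the closing
  edge is kept general to cover both the event alone and its intersection with an open closing
  edge.\<close>

lemma sum_almost_open:
  fixes J p :: "nat \<Rightarrow> real" and l :: "bool \<Rightarrow> real"
  assumes n: "2 \<le> n" and p: "\<And>k. k \<in> {1..n} \<Longrightarrow> 0 < p k"
  defines "a \<equiv> \<lambda>k. exp (2 * J k)"
  defines "L \<equiv> a (n + 1) * (p (n + 1) * l True + (1 - p (n + 1)) * l False)"
  shows "(\<Sum>\<omega>\<in>Pow (cycle_edges n). indicator (almost_open n) \<omega> * l (cycle_edge n (n + 1) \<in> \<omega>) *
      thin_weight {0..n} (cycle_edges n) (on_cycle n J) (on_cycle n p) \<omega>) =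
    (\<Prod>k=1..n. a k * p k) * (1 + (\<Sum>k=1..n. (a k * (1 - p k) + 1) / (a k * p k))) * (L + l False) +
    (\<Prod>k=1..n. a k * p k) * (1 + (\<Sum>k=1..n. (a k * (1 - p k) - 1) / (a k * p k))) * (L - l False)"
proof -
  let ?w = "thin_weight {0..n} (cycle_edges n) (on_cycle n J) (on_cycle n p)" and ?e = "cycle_edge n"
  define h where "h j k b = (if k = n + 1 then l b else of_bool (b \<noteq> (k = j)))" for j k b
  define H where "H j k t = (if t then a k * (p k * h j k True + (1 - p k) * h j k False) else h j k False)" for j k t
  have nz: "a k * p k \<noteq> 0" if "k \<in> {1..n}" for k
    using p[OF that] by (simp add: a_def)
  have "(\<Sum>\<omega>\<in>Pow (cycle_edges n). indicator (almost_open n) \<omega> * l (?e (n + 1) \<in> \<omega>) * ?w \<omega>) =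
      (\<Sum>j=0..n. \<Sum>\<omega>\<in>Pow (cycle_edges n). ((\<Prod>k=1..n. h j k (?e k \<in> \<omega>)) * h j (n + 1) (?e (n + 1) \<in> \<omega>)) * ?w \<omega>)"
  proof (subst sum.swap, intro sum.cong refl)
    fix \<omega> assume "\<omega> \<in> Pow (cycle_edges n)"
    then have "indicator (almost_open n) \<omega> = (\<Sum>j=0..n. \<Prod>k=1..n. h j k (?e k \<in> \<omega>))"
      by (simp add: indicator_almost_open h_def)
    then show "indicator (almost_open n) \<omega> * l (?e (n + 1) \<in> \<omega>) * ?w \<omega> =
        (\<Sum>j=0..n. ((\<Prod>k=1..n. h j k (?e k \<in> \<omega>)) * h j (n + 1) (?e (n + 1) \<in> \<omega>)) * ?w \<omega>)"
      by (simp add: sum_distrib_right h_def)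
  qed
  also have "\<dots> = (\<Sum>j=0..n. (\<Prod>k=1..n. H j k True + H j k False) * (H j (n + 1) True + H j (n + 1) False) +
    (\<Prod>k=1..n. H j k True - H j k False) * (H j (n + 1) True - H j (n + 1) False))"
    unfolding sum_thin_weight_cycle[OF n] H_def a_def by simp
  also have "\<dots> = (\<Sum>j=0..n. (\<Prod>k=1..n. if k = j then a k * (1 - p k) + 1 else a k * p k)) * (L + l False) +
     (\<Sum>j=0..n. (\<Prod>k=1..n. if k = j then a k * (1 - p k) - 1 else a k * p k)) * (L - l False)"
    unfolding sum_distrib_right sum.distrib[symmetric]
    by (intro sum.cong refl arg_cong2[where f = "(+)"] arg_cong2[where f = "(*)"] prod.cong)
       (auto simp: H_def h_def L_def)
  finally show ?thesis
    by (simp only: sum_prod_single_swap[of n "\<lambda>k. a k * p k", OF nz])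
qed

lemma sum_last_edge:
  fixes J p :: "nat \<Rightarrow> real" and l :: "bool \<Rightarrow> real"
  assumes n: "2 \<le> n"
  defines "a \<equiv> \<lambda>k. exp (2 * J k)"
  defines "L \<equiv> a (n + 1) * (p (n + 1) * l True + (1 - p (n + 1)) * l False)"
  shows "(\<Sum>\<omega>\<in>Pow (cycle_edges n). l (cycle_edge n (n + 1) \<in> \<omega>) *
      thin_weight {0..n} (cycle_edges n) (on_cycle n J) (on_cycle n p) \<omega>) =
    (\<Prod>k=1..n. a k + 1) * (L + l False) + (\<Prod>k=1..n. a k - 1) * (L - l False)"
  using sum_thin_weight_cycle[OF n, of "\<lambda>k b. if k = n + 1 then l b else 1" J p]
  by (simp add: a_def L_def)

section \<open>Failure of weak FKG and weak monotonicity on a cycle\<close>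

lemma energy_field_cycle_counterexample:
  fixes J p :: "nat \<Rightarrow> real"
  assumes J: "\<And>k. k \<in> {1..n} \<Longrightarrow> 0 < J k" and p: "\<And>k. k \<in> {1..n+1} \<Longrightarrow> 0 < p k \<and> p k \<le> 1"
    and sum: "1 < (\<Sum>k=1..n. (p k - (1 - exp (- 2 * J k))) / p k)"
    and j: "0 < j" "j < j'"
  shows "2 \<le> n"
    and "\<not> weak_FKG (cycle_edges n) (on_cycle n p) (energy_field {0..n} (cycle_edges n) (on_cycle n (J(n + 1 := j))))"
    and "\<not> weakly_dominated (cycle_edges n) (on_cycle n p)
      (energy_field {0..n} (cycle_edges n) (on_cycle n (J(n + 1 := j))))
      (energy_field {0..n} (cycle_edges n) (on_cycle n (J(n + 1 := j'))))"
proof -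
  show n: "2 \<le> n"
  proof (rule ccontr)
    assume "\<not> 2 \<le> n"
    then consider "n = 0" | "n = 1" by linarith
    then show False
    proof cases
      case 2
      \<comment> \<open>Each summand is 1 minus a positive ratio, so a single one cannot exceed
        1.\<close>
      have "(p 1 - (1 - exp (- 2 * J 1))) / p 1 < 1"
        using J[of 1] p[of 1] 2 by (simp add: divide_less_eq)
      then show False
        using sum 2 by simp
    qed (use sum in simp)
  qed
  let ?E = "cycle_edges n" and ?q = "on_cycle n p" and ?e = "cycle_edge n (n + 1)" and ?A = "almost_open n"
  let ?\<mu> = "\<lambda>i. thinning ?E ?q (energy_field {0..n} ?E (on_cycle n (J(n + 1 := i))))"
  let ?w = "\<lambda>i. thin_weight {0..n} ?E (on_cycle n (J(n + 1 := i))) ?q"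
  define a where "a k = exp (2 * J k)" for k
  define Q U V R T where "Q = (\<Prod>k=1..n. a k * p k)"
    and "U = Q * (1 + (\<Sum>k=1..n. (a k * (1 - p k) + 1) / (a k * p k)))"
    and "V = Q * (1 + (\<Sum>k=1..n. (a k * (1 - p k) - 1) / (a k * p k)))"
    and "R = (\<Prod>k=1..n. a k + 1)" and "T = (\<Prod>k=1..n. a k - 1)"
  \<comment> \<open>Unnormalised masses at closing coupling \<open>i\<close>: of the whole space, of
    the event, of an open closing edge, and of both together.\<close>
  define Z PA PB PAB where "Z i = R * (exp (2 * i) + 1) + T * (exp (2 * i) - 1)"
    and "PA i = U * (exp (2 * i) + 1) + V * (exp (2 * i) - 1)"
    and "PB i = (R + T) * exp (2 * i) * p (n + 1)"
    and "PAB i = (U + V) * exp (2 * i) * p (n + 1)" for i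
  have "Q > 0"
    unfolding Q_def using p by (intro prod_pos) (simp add: a_def)
  \<comment> \<open>Cancelling \<open>a k\<close> turns the sum in \<open>V\<close> into minus the
    sum of the hypothesis, so \<open>V / Q\<close> is 1 minus a number above 1.\<close>
  have "(\<Sum>k=1..n. (a k * (1 - p k) - 1) / (a k * p k)) = - (\<Sum>k=1..n. (p k - (1 - exp (- 2 * J k))) / p k)"
    unfolding sum_negf[symmetric]
  proof (intro sum.cong refl)
    fix k assume "k \<in> {1..n}"
    then show "(a k * (1 - p k) - 1) / (a k * p k) = - ((p k - (1 - exp (- 2 * J k))) / p k)"
      using p[of k] by (simp add: a_def exp_minus field_simps)
  qed
  then have "V < 0"
    unfolding V_def using sum \<open>Q > 0\<close> by (simp add: mult_pos_neg)
  have "0 \<le> (\<Sum>k=1..n. (a k * (1 - p k) + 1) / (a k * p k))"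
    using p by (intro sum_nonneg divide_nonneg_nonneg add_nonneg_nonneg mult_nonneg_nonneg) (auto simp: a_def less_imp_le)
  then have "U > 0"
    unfolding U_def using \<open>Q > 0\<close> by simp
  have "R > 0"
    unfolding R_def by (intro prod_pos) (simp add: a_def add_pos_pos)
  have "T > 0"
    unfolding T_def using J by (intro prod_pos) (simp add: a_def)
  have UT_VR: "V * R < U * T"
    using mult_neg_pos[OF \<open>V < 0\<close> \<open>R > 0\<close>] mult_pos_pos[OF \<open>U > 0\<close> \<open>T > 0\<close>] by linarith
  have q: "0 \<le> ?q e \<and> ?q e \<le> 1" if "e \<in> ?E" for e
    using that p by (auto simp: cycle_edges_def on_cycle_cycle_edge[OF n] less_imp_le simp del: One_nat_def)
  have V: "finite {0..n}" and E: "finite ?E"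
    by (simp_all add: cycle_edges_def)
  \<comment> \<open>Changing the closing coupling does not affect the path edges, so
    \<open>Q\<close>, \<open>U\<close>, \<open>V\<close>, \<open>R\<close>, \<open>T\<close> do not
    depend on \<open>i\<close>.\<close>
  have upd: "(\<Prod>k=1..n. F (exp (2 * (J(n + 1 := i)) k)) (p k)) = (\<Prod>k=1..n. F (a k) (p k))"
    "(\<Sum>k=1..n. F (exp (2 * (J(n + 1 := i)) k)) (p k)) = (\<Sum>k=1..n. F (a k) (p k))"
    for i and F :: "real \<Rightarrow> real \<Rightarrow> real"
    by (auto simp: a_def intro!: prod.cong sum.cong)
  have p_pos: "0 < p k" if "k \<in> {1..n}" for k
    using p[of k] that by simp
  have open_sum: "(\<Sum>\<omega>\<in>Pow ?E. indicator ?A \<omega> * l (?e \<in> \<omega>) * ?w i \<omega>) =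
      U * (exp (2 * i) * (p (n + 1) * l True + (1 - p (n + 1)) * l False) + l False) +
      V * (exp (2 * i) * (p (n + 1) * l True + (1 - p (n + 1)) * l False) - l False)" for i l
    using sum_almost_open[OF n p_pos, where l = l and J = "J(n + 1 := i)"]
      upd(1)[of "\<lambda>a p. a * p" i] upd(2)[of "\<lambda>a p. (a * (1 - p) + 1) / (a * p)" i]
      upd(2)[of "\<lambda>a p. (a * (1 - p) - 1) / (a * p)" i]
    by (simp only: U_def V_def Q_def fun_upd_same)
  have last_sum: "(\<Sum>\<omega>\<in>Pow ?E. l (?e \<in> \<omega>) * ?w i \<omega>) =
      R * (exp (2 * i) * (p (n + 1) * l True + (1 - p (n + 1)) * l False) + l False) +
      T * (exp (2 * i) * (p (n + 1) * l True + (1 - p (n + 1)) * l False) - l False)" for i l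
    using sum_last_edge[OF n, where l = l and J = "J(n + 1 := i)" and p = p]
      upd(1)[of "\<lambda>a p. a + 1" i] upd(1)[of "\<lambda>a p. a - 1" i]
    by (simp only: R_def T_def fun_upd_same)
  have Z: "ising_partition {0..n} ?E (on_cycle n (J(n + 1 := i))) = Z i" for i
    using last_sum[of "\<lambda>_. 1" i] ising_partition_eq_sum_thin_weight[OF V E q, where J = "on_cycle n (J(n + 1 := i))"]
    by (simp add: Z_def)
  have Z_pos: "0 < Z i" for i
    using ising_partition_pos[OF V, of ?E "on_cycle n (J(n + 1 := i))"] by (simp only: Z)
  define f g :: "nat set set \<Rightarrow> real" where "f = indicator ?A" and "g \<omega> = of_bool (?e \<in> \<omega>)" for \<omega>
  have Ef: "measure_pmf.expectation (?\<mu> i) f = PA i / Z i" for i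
    using open_sum[of "\<lambda>_. 1" i] by (simp add: prob_thinning[OF V E q] Z[simplified] PA_def f_def)
  have Eg: "measure_pmf.expectation (?\<mu> i) g = PB i / Z i" for i
    using last_sum[of of_bool i] by (simp add: expectation_thinning[OF V E q] Z[simplified] PB_def g_def algebra_simps)
  have Efg: "measure_pmf.expectation (?\<mu> i) (\<lambda>\<omega>. f \<omega> * g \<omega>) = PAB i / Z i" for i
    using open_sum[of of_bool i]
    by (simp add: expectation_thinning[OF V E q] Z[simplified] PAB_def f_def g_def algebra_simps)
  have mono: "mono_on (Pow ?E) f" "mono_on (Pow ?E) g"
    using increasing_almost_open[of n]
    by (auto simp: mono_on_def f_def g_def indicator_def increasing_event_def)
  \<comment> \<open>The \<open>U * R\<close> and \<open>V * T\<close> terms cancel, so the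
    covariance has the sign of \<open>V * R - U * T\<close>.\<close>
  have "PA j * PB j - PAB j * Z j = 2 * exp (2 * j) * p (n + 1) * (U * T - V * R)"
    by (simp add: PA_def PB_def PAB_def Z_def algebra_simps)
  moreover have "0 < 2 * exp (2 * j) * p (n + 1) * (U * T - V * R)"
    using UT_VR p[of "n + 1"] by simp
  ultimately have "PAB j * Z j < PA j * PB j"
    by linarith
  then have less: "PAB j / Z j < PA j / Z j * (PB j / Z j)"
    using Z_pos[of j] by (simp add: field_simps)
  show "\<not> weak_FKG ?E ?q (energy_field {0..n} ?E (on_cycle n (J(n + 1 := j))))"
  proof
    assume "weak_FKG ?E ?q (energy_field {0..n} ?E (on_cycle n (J(n + 1 := j))))"
    then have "measure_pmf.expectation (?\<mu> j) f * measure_pmf.expectation (?\<mu> j) g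
        \<le> measure_pmf.expectation (?\<mu> j) (\<lambda>\<omega>. f \<omega> * g \<omega>)"
      using mono unfolding weak_FKG_def by simp
    then show False
      using less unfolding Ef Eg Efg by linarith
  qed
  \<comment> \<open>As a function of \<open>exp (2 * i)\<close>, \<open>PA i / Z i\<close> is a
    Moebius transformation whose determinant has the same negative sign, hence strictly
    decreasing.\<close>
  have "PA j * Z j' - PA j' * Z j = 2 * (exp (2 * j') - exp (2 * j)) * (U * T - V * R)"
    by (simp add: PA_def Z_def algebra_simps)
  moreover have "0 < 2 * (exp (2 * j') - exp (2 * j)) * (U * T - V * R)"
    using UT_VR j by simp
  ultimately have "PA j' * Z j < PA j * Z j'"
    by linarith
  then have "PA j' / Z j' < PA j / Z j"
    using Z_pos[of j] Z_pos[of j'] by (simp add: field_simps)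
  then have "\<not> measure_pmf.prob (?\<mu> j) ?A \<le> measure_pmf.prob (?\<mu> j') ?A"
    using Ef[of j] Ef[of j'] by (simp add: f_def)
  then show "\<not> weakly_dominated ?E ?q (energy_field {0..n} ?E (on_cycle n (J(n + 1 := j))))
      (energy_field {0..n} ?E (on_cycle n (J(n + 1 := j'))))"
    using increasing_almost_open[of n] unfolding weakly_dominated_def stoch_dominated_def
    by blast
qed

theorem theorem4p1:
  shows "(\<forall>(V :: 'a set) (E :: 'a set set) (J :: 'a set \<Rightarrow> real) (p :: 'a set \<Rightarrow> real).
            finite_graph V E \<longrightarrow>
            (\<forall>e\<in>E. 0 < J e) \<longrightarrow>
            (\<forall>e\<in>E. 0 < p e \<and> p e \<le> 1) \<longrightarrow>
            (\<forall>e\<in>E. p e \<le> 1 - exp (- 2 * J e)) \<longrightarrow>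
              weak_FKG E p (energy_field V E J) \<and>
              (\<forall>J1 J2 :: 'a set \<Rightarrow> real.
                 (\<forall>e\<in>E. J e \<le> J1 e \<and> J1 e \<le> J2 e) \<longrightarrow>
                 weakly_dominated E p (energy_field V E J1) (energy_field V E J2)))
       \<and>
         (\<forall>(n :: nat) (J :: nat \<Rightarrow> real) (p :: nat \<Rightarrow> real).
            (\<forall>k\<in>{1..n}. 0 < J k) \<longrightarrow>
            (\<forall>k\<in>{1..n+1}. 0 < p k \<and> p k \<le> 1) \<longrightarrow>
            (\<Sum>k=1..n. (p k - (1 - exp (- 2 * J k))) / p k) > 1 \<longrightarrow>
              (\<exists>(V :: nat set) (E :: nat set set) (edge :: nat \<Rightarrow> nat set)
                 (pG :: nat set \<Rightarrow> real) (JG :: nat set \<Rightarrow> real).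
                 finite_graph V E \<and>
                 bij_betw edge {1..n+1} E \<and>
                 (\<forall>k\<in>{1..n+1}. pG (edge k) = p k) \<and>
                 (\<forall>e\<in>E. 0 < JG e) \<and>
                 (\<forall>k\<in>{1..n}. JG (edge k) = J k) \<and>
                 \<not> weak_FKG E pG (energy_field V E JG) \<and>
                 (\<exists>JG' :: nat set \<Rightarrow> real.
                    (\<forall>e\<in>E. JG e \<le> JG' e) \<and>
                    \<not> weakly_dominated E pG (energy_field V E JG) (energy_field V E JG'))))"
proof (rule conjI; intro allI impI)
  fix V :: "'a set" and E :: "'a set set" and J p :: "'a set \<Rightarrow> real"
  assume G: "finite_graph V E" and p: "\<forall>e\<in>E. 0 < p e \<and> p e \<le> 1" "\<forall>e\<in>E. p e \<le> 1 - exp (- 2 * J e)"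
  have V: "finite V" and E: "finite E" and sub: "\<And>e. e \<in> E \<Longrightarrow> e \<subseteq> V"
    using G finite_graph_finite_edges[OF G] by (auto simp: finite_graph_def)
  show "weak_FKG E p (energy_field V E J) \<and>
    (\<forall>J1 J2. (\<forall>e\<in>E. J e \<le> J1 e \<and> J1 e \<le> J2 e) \<longrightarrow>
      weakly_dominated E p (energy_field V E J1) (energy_field V E J2))"
  proof (intro conjI allI impI)
    show "weak_FKG E p (energy_field V E J)"
      using p by (intro weak_FKG_energy_field V E sub) (auto simp: less_imp_le)
    fix J1 J2 :: "'a set \<Rightarrow> real"
    assume J12: "\<forall>e\<in>E. J e \<le> J1 e \<and> J1 e \<le> J2 e"
    \<comment> \<open>The threshold increases with the coupling, so \<open>J1\<close> can serve as
      the reference coupling in the comparison with \<open>J2\<close>.\<close>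
    have "p e \<le> 1 - exp (- 2 * J1 e)" if "e \<in> E" for e
    proof -
      have "exp (- 2 * J1 e) \<le> exp (- 2 * J e)"
        using J12 that by simp
      then show ?thesis
        using p(2)[rule_format, OF that] by linarith
    qed
    then show "weakly_dominated E p (energy_field V E J1) (energy_field V E J2)"
      using p(1) J12 by (intro weakly_dominated_energy_field V E sub) (auto simp: less_imp_le)
  qed
next
  fix n and J p :: "nat \<Rightarrow> real"
  assume J: "\<forall>k\<in>{1..n}. 0 < J k" and p: "\<forall>k\<in>{1..n+1}. 0 < p k \<and> p k \<le> 1"
    and sum: "1 < (\<Sum>k=1..n. (p k - (1 - exp (- 2 * J k))) / p k)"
  let ?J = "\<lambda>j. on_cycle n (J(n + 1 := j))"
  \<comment> \<open>Any two closing couplings \<open>0 < j < j'\<close> would do; 1 and 2 are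
    chosen.\<close>
  note fails = energy_field_cycle_counterexample[OF J[rule_format] p[rule_format] sum, of 1 2]
  have n: "2 \<le> n"
    using fails(1) by simp
  note [simp] = on_cycle_cycle_edge[OF n]
  show "\<exists>V E edge pG JG. finite_graph V E \<and> bij_betw edge {1..n+1} E \<and>
      (\<forall>k\<in>{1..n+1}. pG (edge k) = p k) \<and> (\<forall>e\<in>E. 0 < JG e) \<and> (\<forall>k\<in>{1..n}. JG (edge k) = J k) \<and>
      \<not> weak_FKG E pG (energy_field V E JG) \<and>
      (\<exists>JG' :: nat set \<Rightarrow> real. (\<forall>e\<in>E. JG e \<le> JG' e) \<and>
        \<not> weakly_dominated E pG (energy_field V E JG) (energy_field V E JG'))"
  proof (rule exI[of _ "{0..n}"], rule exI[of _ "cycle_edges n"], rule exI[of _ "cycle_edge n"],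
      rule exI[of _ "on_cycle n p"], rule exI[of _ "?J 1"], intro conjI exI[of _ "?J 2"])
    show "bij_betw (cycle_edge n) {1..n+1} (cycle_edges n)"
      using inj_on_cycle_edge[OF n] by (simp add: bij_betw_def cycle_edges_def)
    show "\<forall>e\<in>cycle_edges n. 0 < ?J 1 e" "\<forall>e\<in>cycle_edges n. ?J 1 e \<le> ?J 2 e"
      using J by (auto simp: cycle_edges_def simp del: One_nat_def)
  qed (use fails finite_graph_cycle[OF n] in auto)
qed

end
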